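(* For every nested sequent $\Gamma$, $\Gamma$ is derivable in $\mathbf{SS4}$ if and only if $\Gamma$ is derivable in $\mathbf{DS4}$.
   Context: Formulae are in negation normal form over $a,\neg a,\lor,\land,\square,\blacksquare,\lozenge,\lozenge^{\bullet}$ ($\lozenge^{\bullet}$ the past diamond, dual of $\blacksquare$). Nested sequents are multisets of formulae and structures $\circ\{\Gamma\}$, $\bullet\{\Delta\}$; $\Sigma[\,]$ is a context with a hole at any depth. $\mathbf{SKt}$ is the shallow calculus: $id$ ($\Gamma,a,\overline a$), $cut$, $\land$, $\lor$, $ctr$, $wk$, $rf$ (from $\Gamma,\circ\{\Delta\}$ infer $\bullet\{\Gamma\},\Delta$), $rp$ (from $\Gamma,\bullet\{\Delta\}$ infer $\circ\{\Gamma\},\Delta$), $\blacksquare$ (from $\Gamma,\bullet\{A\}$ infer $\Gamma,\blacksquare A$), $\square$ (from $\Gamma,\circ\{A\}$ infer $\Gamma,\square A$), $\lozenge^{\bullet}$ (from $\Gamma,\bullet\{\Delta,A\}$ infer $\Gamma,\bullet\{\Delta\},\lozenge^{\bullet}A$), $\lozenge$ (from $\Gamma,\circ\{\Delta,A\}$ infer $\Gamma,\circ\{\Delta\},\lozenge A$). $\mathbf{SS4}$ is $\mathbf{SKt}$ plus $T_f$: from $\Gamma,\circ\{\Delta\}$ infer $\Gamma,\Delta$, and $4_f$: from $\Gamma,\circ\{\Delta\}$ infer $\Gamma,\circ\{\circ\{\Delta\}\}$. $\mathbf{DKt}$ is the deep calculus: $id$: $\Sigma[a,\overline a]$; $\land$: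 from $\Sigma[A\land B,A]$, $\Sigma[A\land B,B]$ infer $\Sigma[A\land B]$; $\lor$: from $\Sigma[A\lor B,A,B]$ infer $\Sigma[A\lor B]$; $\blacksquare$: from $\Sigma[\blacksquare A,\bullet\{A\}]$ infer $\Sigma[\blacksquare A]$; $\square$: from $\Sigma[\square A,\circ\{A\}]$ infer $\Sigma[\square A]$; $\lozenge^{\bullet}_1$: from $\Sigma[\bullet\{\Delta,A\},\lozenge^{\bullet}A]$ infer $\Sigma[\bullet\{\Delta\},\lozenge^{\bullet}A]$; $\lozenge^{\bullet}_2$: from $\Sigma[\circ\{\Delta,\lozenge^{\bullet}A\},A]$ infer $\Sigma[\circ\{\Delta,\lozenge^{\bullet}A\}]$; $\lozenge_1$: from $\Sigma[\circ\{\Delta,A\},\lozenge A]$ infer $\Sigma[\circ\{\Delta\},\lozenge A]$; $\lozenge_2$: from $\Sigma[\bullet\{\Delta,\lozenge A\},A]$ infer $\Sigma[\bullet\{\Delta,\lozenge A\}]$. $\mathbf{DS4}$ is $\mathbf{DKt}$ plus: $T_a$: from $\Sigma[\lozenge^{\bullet}A,A]$ infer $\Sigma[\lozenge^{\bullet}A]$; $T_b$: from $\Sigma[\lozenge A,A]$ infer $\Sigma[\lozenge A]$; $4_a$: from $\Sigma[\lozenge^{\bullet}A,\bullet\{\lozenge^{\bullet}A,\Delta\}]$ infer $\Sigma[\lozenge^{\bullet}A,\bullet\{\Delta\}]$; $4_b$: from $\Sigma[\circ\{\Delta,\lozenge^{\bullet}A\},\lozenge^{\bullet}A]$ infer $\Sigma[\circ\{\Delta,\lozenge^{\bullet}A\}]$;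 $4_c$: from $\Sigma[\lozenge A,\circ\{\lozenge A,\Delta\}]$ infer $\Sigma[\lozenge A,\circ\{\Delta\}]$; $4_d$: from $\Sigma[\bullet\{\Delta,\lozenge A\},\lozenge A]$ infer $\Sigma[\bullet\{\Delta,\lozenge A\}]$. *)

theory Defs
  imports Main "HOL-Library.Multiset"
begin

datatype 'a fm =
    Atom 'a
  | NegAtom 'a
  | Or "'a fm" "'a fm"
  | And "'a fm" "'a fm"
  | Box "'a fm"
  | BBox "'a fm" \<comment> \<open>black box, the past modality\<close>
  | Dia "'a fm"
  | BDia "'a fm" \<comment> \<open>past diamond, dual of the black box\<close>

text \<open>Negation is the meta-level dual; it is needed only for the cut rule.\<close>

primrec neg :: "'a fm \<Rightarrow> 'a fm" where
  "neg (Atom a) = NegAtom a"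
| "neg (NegAtom a) = Atom a"
| "neg (Or A B) = And (neg A) (neg B)"
| "neg (And A B) = Or (neg A) (neg B)"
| "neg (Box A) = Dia (neg A)"
| "neg (BBox A) = BDia (neg A)"
| "neg (Dia A) = Box (neg A)"
| "neg (BDia A) = BBox (neg A)"

text \<open>
  A nested sequent is a multiset of items; an item is a formula \<open>F A\<close>, a white structure
  \<open>W \<Delta>\<close> (written with a circle on paper) or a black structure \<open>B \<Delta>\<close> (written with a bullet).
\<close>

datatype 'a item =
    F "'a fm"
  | W "'a item multiset"
  | B "'a item multiset"

type_synonym 'a seq = "'a item multiset"

text \<open>
  In a context the hole may be at any depth; the sequent stored in each constructor is the
  multiset of siblings of the hole, respectively of the structure containing it.
\<close>

datatype 'a ctx =
    Hole "'a seq"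
  | WCtx "'a seq" "'a ctx"
  | BCtx "'a seq" "'a ctx"

primrec fill :: "'a ctx \<Rightarrow> 'a seq \<Rightarrow> 'a seq" where
  "fill (Hole \<Gamma>) \<Theta> = \<Gamma> + \<Theta>"
| "fill (WCtx \<Gamma> \<Sigma>) \<Theta> = \<Gamma> + {#W (fill \<Sigma> \<Theta>)#}"
| "fill (BCtx \<Gamma> \<Sigma>) \<Theta> = \<Gamma> + {#B (fill \<Sigma> \<Theta>)#}"

text \<open>A calculus is a relation between the list of premises and the conclusion of an inference.\<close>

type_synonym 'a calculus = "'a seq list \<Rightarrow> 'a seq \<Rightarrow> bool"

inductive derivable :: "'a calculus \<Rightarrow> 'a seq \<Rightarrow> bool" for R :: "'a calculus" where
  infer: "R ps \<Gamma> \<Longrightarrow> \<forall>p \<in> set ps. derivable R p \<Longrightarrow> derivable R \<Gamma>"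

inductive SKt :: "'a calculus" where
  id: "SKt [] (\<Gamma> + {#F (Atom a), F (NegAtom a)#})"
| cut: "SKt [\<Gamma> + {#F A#}, \<Delta> + {#F (neg A)#}] (\<Gamma> + \<Delta>)"
| conj: "SKt [\<Gamma> + {#F A#}, \<Gamma> + {#F C#}] (\<Gamma> + {#F (And A C)#})"
| disj: "SKt [\<Gamma> + {#F A, F C#}] (\<Gamma> + {#F (Or A C)#})"
| ctr: "SKt [\<Gamma> + \<Delta> + \<Delta>] (\<Gamma> + \<Delta>)"
| wk: "SKt [\<Gamma>] (\<Gamma> + \<Delta>)"
| rf: "SKt [\<Gamma> + {#W \<Delta>#}] ({#B \<Gamma>#} + \<Delta>)"
| rp: "SKt [\<Gamma> + {#B \<Delta>#}] ({#W \<Gamma>#} + \<Delta>)"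
| bbox: "SKt [\<Gamma> + {#B {#F A#}#}] (\<Gamma> + {#F (BBox A)#})"
| box: "SKt [\<Gamma> + {#W {#F A#}#}] (\<Gamma> + {#F (Box A)#})"
| bdia: "SKt [\<Gamma> + {#B (\<Delta> + {#F A#})#}] (\<Gamma> + {#B \<Delta>, F (BDia A)#})"
| dia: "SKt [\<Gamma> + {#W (\<Delta> + {#F A#})#}] (\<Gamma> + {#W \<Delta>, F (Dia A)#})"

inductive SS4 :: "'a calculus" where
  SKt: "SKt ps \<Gamma> \<Longrightarrow> SS4 ps \<Gamma>"
| T_f: "SS4 [\<Gamma> + {#W \<Delta>#}] (\<Gamma> + \<Delta>)"
| four_f: "SS4 [\<Gamma> + {#W \<Delta>#}] (\<Gamma> + {#W {#W \<Delta>#}#})"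

inductive DKt :: "'a calculus" where
  id: "DKt [] (fill \<Sigma> {#F (Atom a), F (NegAtom a)#})"
| conj: "DKt [fill \<Sigma> {#F (And A C), F A#}, fill \<Sigma> {#F (And A C), F C#}]
             (fill \<Sigma> {#F (And A C)#})"
| disj: "DKt [fill \<Sigma> {#F (Or A C), F A, F C#}] (fill \<Sigma> {#F (Or A C)#})"
| bbox: "DKt [fill \<Sigma> {#F (BBox A), B {#F A#}#}] (fill \<Sigma> {#F (BBox A)#})"
| box: "DKt [fill \<Sigma> {#F (Box A), W {#F A#}#}] (fill \<Sigma> {#F (Box A)#})"
| bdia1: "DKt [fill \<Sigma> {#B (\<Delta> + {#F A#}), F (BDia A)#}] (fill \<Sigma> {#B \<Delta>, F (BDia A)#})"
| bdia2: "DKt [fill \<Sigma> {#W (\<Delta> + {#F (BDia A)#}), F A#}] (fill \<Sigma> {#W (\<Delta> + {#F (BDia A)#})#})"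
| dia1: "DKt [fill \<Sigma> {#W (\<Delta> + {#F A#}), F (Dia A)#}] (fill \<Sigma> {#W \<Delta>, F (Dia A)#})"
| dia2: "DKt [fill \<Sigma> {#B (\<Delta> + {#F (Dia A)#}), F A#}] (fill \<Sigma> {#B (\<Delta> + {#F (Dia A)#})#})"

inductive DS4 :: "'a calculus" where
  DKt: "DKt ps \<Gamma> \<Longrightarrow> DS4 ps \<Gamma>"
| T_a: "DS4 [fill \<Sigma> {#F (BDia A), F A#}] (fill \<Sigma> {#F (BDia A)#})"
| T_b: "DS4 [fill \<Sigma> {#F (Dia A), F A#}] (fill \<Sigma> {#F (Dia A)#})"
| four_a: "DS4 [fill \<Sigma> {#F (BDia A), B ({#F (BDia A)#} + \<Delta>)#}] (fill \<Sigma> {#F (BDia A), B \<Delta>#})"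
| four_b: "DS4 [fill \<Sigma> {#W (\<Delta> + {#F (BDia A)#}), F (BDia A)#}]
               (fill \<Sigma> {#W (\<Delta> + {#F (BDia A)#})#})"
| four_c: "DS4 [fill \<Sigma> {#F (Dia A), W ({#F (Dia A)#} + \<Delta>)#}] (fill \<Sigma> {#F (Dia A), W \<Delta>#})"
| four_d: "DS4 [fill \<Sigma> {#B (\<Delta> + {#F (Dia A)#}), F (Dia A)#}]
               (fill \<Sigma> {#B (\<Delta> + {#F (Dia A)#})#})"

end

(*
  DS4 to SS4: the residuation rules rf and rp bring the hole of any context to top level, where the
  deep rules become shallow inferences; the 4-rules of DS4 use a cut with Dia (Dia A).

  SS4 to DS4: SS4 with cut is sound for reflexive transitive Kripke frames, so it suffices that DS4
  is complete for them without cut. A labelled refutation calculus on sets of facts is finitary;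
  if the facts of a nested sequent cannot be refuted, a maximal irrefutable extension (Zorn) is a
  countermodel. A refutation is replayed in DS4 on the tree of the sequent: box steps add a child,
  and a diamond reaches an accessible node by moving along tree edges with the 4-rules.
*)

theory Submission
  imports Defs
begin

section \<open>From the deep to the shallow calculus\<close>

text \<open>Passing from SS4 to DS4 means eliminating cut together with weakening, contraction,
  residuation and the structural T and 4 rules, none of which DS4 has; the semantic detour avoids
  permuting them one by one. Search in DS4 need not terminate, so a countermodel may have to be
  infinite. A maximal irrefutable set yields it at once, without a fair search strategy. Sets of
  labelled facts serve this purpose better than finite trees: contraction is free, weakening is
  monotonicity, and unions of chains exist. Their witness labels carry no freshness condition,
  whereas the replay has to create a genuinely new child for a new witness; the invariant
  \<open>wit_ok\<close> reconciles the two. Taking accessibility as a reflexive transitive closure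
  makes the model an S4 frame by construction, and it turns a diamond step into a finite walk
  between neighbouring nodes, which is how far a single deep rule reaches. Such a walk leaves copies
  of the diamond behind, so the tree may hold more formulae than the refutation records.\<close>

abbreviation ss4 :: "'a seq \<Rightarrow> bool" where
  "ss4 \<equiv> derivable SS4"

section \<open>Shallow rules in \<open>add_mset\<close> form and their past mirror images\<close>

lemma derivable1: "R [p] \<Gamma> \<Longrightarrow> derivable R p \<Longrightarrow> derivable R \<Gamma>"
  by (rule derivable.infer[of R "[p]"]) auto

lemma derivable2: "R [p, q] \<Gamma> \<Longrightarrow> derivable R p \<Longrightarrow> derivable R q \<Longrightarrow> derivable R \<Gamma>"
  by (rule derivable.infer[of R "[p, q]"]) auto

lemma ss4_wk: "ss4 \<Gamma> \<Longrightarrow> ss4 (\<Gamma> + \<Delta>)"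
  by (rule derivable1[of SS4, OF SS4.SKt[OF SKt.wk]])

lemma ss4_ctr: "ss4 (add_mset X (add_mset X \<Gamma>)) \<Longrightarrow> ss4 (add_mset X \<Gamma>)"
  using derivable1[of SS4, OF SS4.SKt[OF SKt.ctr[of \<Gamma> "{#X#}"]]] by simp

lemma ss4_cut: "ss4 (add_mset (F A) \<Gamma>) \<Longrightarrow> ss4 (add_mset (F (neg A)) \<Delta>) \<Longrightarrow> ss4 (\<Gamma> + \<Delta>)"
  using derivable2[of SS4, OF SS4.SKt[OF SKt.cut[of \<Gamma> A \<Delta>]]] by simp

lemma ss4_conj:
  "ss4 (add_mset (F A) \<Gamma>) \<Longrightarrow> ss4 (add_mset (F C) \<Gamma>) \<Longrightarrow> ss4 (add_mset (F (And A C)) \<Gamma>)"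
  using derivable2[of SS4, OF SS4.SKt[OF SKt.conj[of \<Gamma> A C]]] by simp

lemma ss4_disj: "ss4 (add_mset (F A) (add_mset (F C) \<Gamma>)) \<Longrightarrow> ss4 (add_mset (F (Or A C)) \<Gamma>)"
  using derivable1[of SS4, OF SS4.SKt[OF SKt.disj[of \<Gamma> A C]]] by simp

lemma ss4_id: "ss4 (add_mset (F (Atom a)) (add_mset (F (NegAtom a)) \<Gamma>))"
  using derivable.infer[of SS4, OF SS4.SKt[OF SKt.id[of \<Gamma> a]]] by simp

text \<open>The rules \<open>rf\<close> and \<open>rp\<close> are inverse to each other, so
  exchanging the inside of a structure with its surroundings loses nothing.\<close>

lemma ss4_residual: "ss4 (add_mset (W \<Delta>) \<Gamma>) \<longleftrightarrow> ss4 (add_mset (B \<Gamma>) \<Delta>)"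
  using derivable1[of SS4, OF SS4.SKt[OF SKt.rf[of \<Gamma> \<Delta>]]] derivable1[of SS4, OF SS4.SKt[OF SKt.rp[of \<Delta> \<Gamma>]]]
  by auto

lemma ss4_box: "ss4 (add_mset (W {#F A#}) \<Gamma>) \<Longrightarrow> ss4 (add_mset (F (Box A)) \<Gamma>)"
  using derivable1[of SS4, OF SS4.SKt[OF SKt.box[of \<Gamma> A]]] by simp

lemma ss4_bbox: "ss4 (add_mset (B {#F A#}) \<Gamma>) \<Longrightarrow> ss4 (add_mset (F (BBox A)) \<Gamma>)"
  using derivable1[of SS4, OF SS4.SKt[OF SKt.bbox[of \<Gamma> A]]] by simp

lemma ss4_dia: "ss4 (add_mset (W (add_mset (F A) \<Delta>)) \<Gamma>) \<Longrightarrow> ss4 (add_mset (F (Dia A)) (add_mset (W \<Delta>) \<Gamma>))"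
  using derivable1[of SS4, OF SS4.SKt[OF SKt.dia[of \<Gamma> \<Delta> A]]] by (simp add: add_mset_commute)

lemma ss4_bdia: "ss4 (add_mset (B (add_mset (F A) \<Delta>)) \<Gamma>) \<Longrightarrow> ss4 (add_mset (F (BDia A)) (add_mset (B \<Delta>) \<Gamma>))"
  using derivable1[of SS4, OF SS4.SKt[OF SKt.bdia[of \<Gamma> \<Delta> A]]] by (simp add: add_mset_commute)

lemma ss4_T_white: "ss4 (add_mset (W \<Delta>) \<Gamma>) \<Longrightarrow> ss4 (\<Gamma> + \<Delta>)"
  using derivable1[of SS4, OF SS4.T_f[of \<Gamma> \<Delta>]] by simp

lemma ss4_T_black: "ss4 (add_mset (B \<Delta>) \<Gamma>) \<Longrightarrow> ss4 (\<Gamma> + \<Delta>)"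
  using ss4_T_white[of \<Gamma> \<Delta>] by (simp add: ss4_residual[symmetric] add.commute)

lemma ss4_4_white: "ss4 (add_mset (W \<Delta>) \<Gamma>) \<Longrightarrow> ss4 (add_mset (W {#W \<Delta>#}) \<Gamma>)"
  using derivable1[of SS4, OF SS4.four_f[of \<Gamma> \<Delta>]] by simp

text \<open>SS4 has no black 4-rule. Residuation exchanges \<Gamma> and \<Delta>, so the white rule
  can be applied to \<Gamma>; two more residuations rebuild the black nesting.\<close>

lemma ss4_4_black: "ss4 (add_mset (B \<Delta>) \<Gamma>) \<Longrightarrow> ss4 (add_mset (B {#B \<Delta>#}) \<Gamma>)"
proof -
  assume "ss4 (add_mset (B \<Delta>) \<Gamma>)"
  then have "ss4 (add_mset (W {#W \<Gamma>#}) \<Delta>)"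
    by (simp add: ss4_residual[symmetric] ss4_4_white)
  then have "ss4 (add_mset (W \<Gamma>) {#B \<Delta>#})"
    unfolding ss4_residual[of _ \<Delta>] by (simp add: add_mset_commute)
  then show ?thesis
    by (simp only: ss4_residual)
qed

text \<open>An empty structure of the other colour is weakened in; residuation then wraps everything
  else.\<close>

lemma ss4_necessitation_white: "ss4 \<Gamma> \<Longrightarrow> ss4 {#W \<Gamma>#}"
  using ss4_wk[of \<Gamma> "{#B {#}#}"] by (simp add: ss4_residual)

lemma ss4_necessitation_black: "ss4 \<Gamma> \<Longrightarrow> ss4 {#B \<Gamma>#}"
  using ss4_wk[of \<Gamma> "{#W {#}#}"] by (simp add: ss4_residual)

text \<open>The axiom covers atoms only; the cuts on iterated diamonds below need it for compound
  formulae.\<close>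

lemma ss4_identity: "ss4 {#F A, F (neg A)#}"
proof (induction A)
  case (Atom a)
  then show ?case using ss4_id[of a "{#}"] by simp
next
  case (NegAtom a)
  then show ?case using ss4_id[of a "{#}"] by (simp add: add_mset_commute)
next
  case (Or A C)
  have "ss4 {#F A, F C, F (neg A)#}" "ss4 {#F A, F C, F (neg C)#}"
    using ss4_wk[OF Or(1), of "{#F C#}"] ss4_wk[OF Or(2), of "{#F A#}"]
    by (simp_all add: add_mset_commute)
  then have "ss4 {#F (neg A), F (Or A C)#}" "ss4 {#F (neg C), F (Or A C)#}"
    by (simp_all only: ss4_disj add_mset_commute[of "F (neg _)"])
  then show ?case
    using ss4_conj[of "neg A" "{#F (Or A C)#}" "neg C"] by (simp add: add_mset_commute)
next
  case (And A C)
  have "ss4 {#F (neg A), F (neg C), F A#}" "ss4 {#F (neg A), F (neg C), F C#}"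
    using ss4_wk[OF And(1), of "{#F (neg C)#}"] ss4_wk[OF And(2), of "{#F (neg A)#}"]
    by (simp_all add: add_mset_commute)
  then have "ss4 {#F A, F (neg (And A C))#}" "ss4 {#F C, F (neg (And A C))#}"
    using ss4_disj[of "neg A" "neg C" "{#F A#}"] ss4_disj[of "neg A" "neg C" "{#F C#}"]
    by (simp_all add: add_mset_commute)
  then show ?case
    by (rule ss4_conj)
next
  case (Box A)
  have "ss4 {#W {#F (neg A), F A#}#}"
    using ss4_necessitation_white[OF Box] by (simp add: add_mset_commute)
  then show ?case
    using ss4_dia[of "neg A" "{#F A#}" "{#}"] ss4_box[of A "{#F (Dia (neg A))#}"]
    by (simp add: add_mset_commute)
next
  case (BBox A)
  have "ss4 {#B {#F (neg A), F A#}#}"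
    using ss4_necessitation_black[OF BBox] by (simp add: add_mset_commute)
  then show ?case
    using ss4_bdia[of "neg A" "{#F A#}" "{#}"] ss4_bbox[of A "{#F (BDia (neg A))#}"]
    by (simp add: add_mset_commute)
next
  case (Dia A)
  show ?case
    using ss4_dia[of A "{#F (neg A)#}" "{#}"] ss4_necessitation_white[OF Dia]
      ss4_box[of "neg A" "{#F (Dia A)#}"]
    by (simp add: add_mset_commute)
next
  case (BDia A)
  show ?case
    using ss4_bdia[of A "{#F (neg A)#}" "{#}"] ss4_necessitation_black[OF BDia]
      ss4_bbox[of "neg A" "{#F (BDia A)#}"]
    by (simp add: add_mset_commute)
qed

text \<open>The 4-rule of SS4 acts on structures, so it cannot shorten \<open>Dia (Dia A)\<close>
  directly. Instead the dual sequent with \<open>Box (Box (neg A))\<close> and \<open>Dia A\<close>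
  is derived and cut against the hypothesis.\<close>

lemma ss4_dia_dia: "ss4 (add_mset (F (Dia (Dia A))) \<Gamma>) \<Longrightarrow> ss4 (add_mset (F (Dia A)) \<Gamma>)"
proof -
  assume *: "ss4 (add_mset (F (Dia (Dia A))) \<Gamma>)"
  have "ss4 {#W {#F (neg A)#}, F (Dia A)#}"
    using ss4_dia[of A "{#F (neg A)#}" "{#}"] ss4_necessitation_white[OF ss4_identity[of A]]
    by (simp add: add_mset_commute)
  \<comment> \<open>The 4-rule nests the circle once more, and residuation brings the inner circle
    to top level, where \<open>ss4_box\<close> applies.\<close>
  then have "ss4 {#W {#F (neg A)#}, B {#F (Dia A)#}#}"
    using ss4_4_white[of "{#F (neg A)#}" "{#F (Dia A)#}"]
    unfolding ss4_residual[of "{#W {#F (neg A)#}#}"] by (simp add: add_mset_commute)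
  then have "ss4 {#F (Box (neg A)), B {#F (Dia A)#}#}"
    by (rule ss4_box)
  then have "ss4 {#W {#F (Box (neg A))#}, F (Dia A)#}"
    using ss4_residual[of "{#F (Box (neg A))#}" "{#F (Dia A)#}"] by (simp add: add_mset_commute)
  then have "ss4 {#F (neg (Dia (Dia A))), F (Dia A)#}"
    using ss4_box[of "Box (neg A)" "{#F (Dia A)#}"] by simp
  from ss4_cut[OF * this] show ?thesis
    by simp
qed

lemma ss4_bdia_bdia: "ss4 (add_mset (F (BDia (BDia A))) \<Gamma>) \<Longrightarrow> ss4 (add_mset (F (BDia A)) \<Gamma>)"
proof -
  assume *: "ss4 (add_mset (F (BDia (BDia A))) \<Gamma>)"
  have "ss4 {#B {#F (neg A)#}, F (BDia A)#}"
    using ss4_bdia[of A "{#F (neg A)#}" "{#}"] ss4_necessitation_black[OF ss4_identity[of A]]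
    by (simp add: add_mset_commute)
  then have "ss4 {#B {#F (neg A)#}, W {#F (BDia A)#}#}"
    using ss4_4_black[of "{#F (neg A)#}" "{#F (BDia A)#}"]
    unfolding ss4_residual[symmetric, of "{#B {#F (neg A)#}#}"] by (simp add: add_mset_commute)
  then have "ss4 {#F (BBox (neg A)), W {#F (BDia A)#}#}"
    by (rule ss4_bbox)
  then have "ss4 {#B {#F (BBox (neg A))#}, F (BDia A)#}"
    using ss4_residual[of "{#F (BDia A)#}" "{#F (BBox (neg A))#}"] by (simp add: add_mset_commute)
  then have "ss4 {#F (neg (BDia (BDia A))), F (BDia A)#}"
    using ss4_bbox[of "BBox (neg A)" "{#F (BDia A)#}"] by simp
  from ss4_cut[OF * this] show ?thesis
    by simp
qed

text \<open>Everything is put inside a circle, the diamond rule moves \<open>A\<close> out as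
  \<open>Dia A\<close>, and T removes the circle around \<Gamma>.\<close>

lemma ss4_dia_intro: "ss4 (add_mset (F A) \<Gamma>) \<Longrightarrow> ss4 (add_mset (F (Dia A)) \<Gamma>)"
  using ss4_T_white[OF _, of \<Gamma> "{#F (Dia A)#}"] ss4_dia[of A \<Gamma> "{#}"]
    ss4_necessitation_white[of "add_mset (F A) \<Gamma>"]
  by (simp add: add_mset_commute)

lemma ss4_bdia_intro: "ss4 (add_mset (F A) \<Gamma>) \<Longrightarrow> ss4 (add_mset (F (BDia A)) \<Gamma>)"
  using ss4_T_black[OF _, of \<Gamma> "{#F (BDia A)#}"] ss4_bdia[of A \<Gamma> "{#}"]
    ss4_necessitation_black[of "add_mset (F A) \<Gamma>"]
  by (simp add: add_mset_commute)

section \<open>Simulating deep inferences at top level\<close>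

lemma ss4_display: "\<exists>\<Gamma>. \<forall>\<Theta>. ss4 (\<Delta> + fill \<Sigma> \<Theta>) \<longleftrightarrow> ss4 (\<Gamma> + \<Theta>)"
proof (induction \<Sigma> arbitrary: \<Delta>)
  case (Hole \<Gamma>)
  show ?case by (rule exI[of _ "\<Delta> + \<Gamma>"]) (simp add: add.assoc)
next
  case (WCtx \<Gamma> \<Sigma>)
  show ?case
    using WCtx[of "{#B (\<Delta> + \<Gamma>)#}"] ss4_residual[of "fill \<Sigma> _" "\<Delta> + \<Gamma>"] by simp
next
  case (BCtx \<Gamma> \<Sigma>)
  show ?case
    using BCtx[of "{#W (\<Delta> + \<Gamma>)#}"] ss4_residual[of "\<Delta> + \<Gamma>" "fill \<Sigma> _"] by simp
qed

lemma ss4_deep: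
  assumes "\<And>\<Gamma>. \<forall>p \<in> set ps. ss4 (\<Gamma> + p) \<Longrightarrow> ss4 (\<Gamma> + \<Theta>)"
    and "\<forall>p \<in> set ps. ss4 (fill \<Sigma> p)"
  shows "ss4 (fill \<Sigma> \<Theta>)"
proof -
  obtain \<Gamma> where "\<And>\<Theta>. ss4 ({#} + fill \<Sigma> \<Theta>) \<longleftrightarrow> ss4 (\<Gamma> + \<Theta>)"
    using ss4_display by blast
  then show ?thesis
    using assms by simp
qed

lemma ss4_deep1:
  assumes "ss4 (fill \<Sigma> p)" and "\<And>\<Gamma>. ss4 (\<Gamma> + p) \<Longrightarrow> ss4 (\<Gamma> + \<Theta>)"
  shows "ss4 (fill \<Sigma> \<Theta>)"
  using ss4_deep[of "[p]"] assms by simp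

text \<open>Deep rules keep the principal item in their premises and shallow rules consume it.
  Putting a spare copy of \<open>X\<close> into the side sequent and contracting at the end bridges
  the difference.\<close>

lemma ss4_deep_principal:
  assumes "\<And>\<Gamma>. \<forall>\<Theta> \<in> set ps. ss4 (\<Gamma> + \<Theta>) \<Longrightarrow> ss4 (add_mset X \<Gamma>)"
    and "\<forall>\<Theta> \<in> set ps. ss4 (fill \<Sigma> (add_mset X \<Theta>))"
  shows "ss4 (fill \<Sigma> {#X#})"
proof (rule ss4_deep[of "map (add_mset X) ps"])
  fix \<Gamma> assume "\<forall>p \<in> set (map (add_mset X) ps). ss4 (\<Gamma> + p)"
  then have "ss4 (add_mset X (add_mset X \<Gamma>))"
    using assms(1)[of "add_mset X \<Gamma>"] by simp
  then show "ss4 (\<Gamma> + {#X#})"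
    using ss4_ctr by simp
qed (use assms(2) in simp)

lemma ss4_dkt:
  assumes "DKt ps \<Gamma>" and "\<forall>p \<in> set ps. ss4 p"
  shows "ss4 \<Gamma>"
  using assms
proof cases
  case (id \<Sigma> a)
  show ?thesis
    unfolding id by (rule ss4_deep[of "[]"]) (auto simp: ss4_id)
next
  case (conj \<Sigma> A C)
  show ?thesis
    unfolding conj
    by (rule ss4_deep_principal[of "[{#F A#}, {#F C#}]"])
      (use assms(2) conj in \<open>auto intro: ss4_conj\<close>)
next
  case (disj \<Sigma> A C)
  show ?thesis
    unfolding disj
    by (rule ss4_deep_principal[of "[{#F A, F C#}]"])
      (use assms(2) disj in \<open>auto intro: ss4_disj\<close>)
next
  case (bbox \<Sigma> A)
  show ?thesis
    unfolding bbox
    by (rule ss4_deep_principal[of "[{#B {#F A#}#}]"])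
      (use assms(2) bbox in \<open>auto intro: ss4_bbox\<close>)
next
  case (box \<Sigma> A)
  show ?thesis
    unfolding box
    by (rule ss4_deep_principal[of "[{#W {#F A#}#}]"])
      (use assms(2) box in \<open>auto intro: ss4_box\<close>)
next
  case (bdia1 \<Sigma> \<Delta> A)
  show ?thesis
    unfolding bdia1
  proof (rule ss4_deep1)
    show "ss4 (fill \<Sigma> {#B (\<Delta> + {#F A#}), F (BDia A)#})"
      using assms(2) bdia1 by simp
    fix \<Gamma> assume "ss4 (\<Gamma> + {#B (\<Delta> + {#F A#}), F (BDia A)#})"
    then show "ss4 (\<Gamma> + {#B \<Delta>, F (BDia A)#})"
      using ss4_ctr[OF ss4_bdia[of A \<Delta> "add_mset (F (BDia A)) \<Gamma>", unfolded add_mset_commute[of "B \<Delta>"]]]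
      by (simp add: add_mset_commute)
  qed
next
  case (bdia2 \<Sigma> \<Delta> A)
  show ?thesis
    unfolding bdia2
  proof (rule ss4_deep1)
    show "ss4 (fill \<Sigma> {#W (\<Delta> + {#F (BDia A)#}), F A#})"
      using assms(2) bdia2 by simp
    fix \<Gamma> assume "ss4 (\<Gamma> + {#W (\<Delta> + {#F (BDia A)#}), F A#})"
    then have "ss4 (add_mset (W (add_mset (F (BDia A)) \<Delta>)) (add_mset (F A) \<Gamma>))"
      by (simp add: add_mset_commute)
    \<comment> \<open>Seen from inside the circle, the surroundings form a black structure next to
      \<open>BDia A\<close>, which is the shape that the shallow rule expects.\<close>
    then have "ss4 (add_mset (B (add_mset (F A) \<Gamma>)) (add_mset (F (BDia A)) \<Delta>))"
      by (simp only: ss4_residual)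
    then have "ss4 (add_mset (B \<Gamma>) (add_mset (F (BDia A)) \<Delta>))"
      using ss4_ctr[OF ss4_bdia[of A \<Gamma> "add_mset (F (BDia A)) \<Delta>", unfolded add_mset_commute[of "B \<Gamma>"]]]
      by (simp add: add_mset_commute)
    then show "ss4 (\<Gamma> + {#W (\<Delta> + {#F (BDia A)#})#})"
      by (simp add: ss4_residual)
  qed
next
  case (dia1 \<Sigma> \<Delta> A)
  show ?thesis
    unfolding dia1
  proof (rule ss4_deep1)
    show "ss4 (fill \<Sigma> {#W (\<Delta> + {#F A#}), F (Dia A)#})"
      using assms(2) dia1 by simp
    fix \<Gamma> assume "ss4 (\<Gamma> + {#W (\<Delta> + {#F A#}), F (Dia A)#})"
    then show "ss4 (\<Gamma> + {#W \<Delta>, F (Dia A)#})"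
      using ss4_ctr[OF ss4_dia[of A \<Delta> "add_mset (F (Dia A)) \<Gamma>", unfolded add_mset_commute[of "W \<Delta>"]]]
      by (simp add: add_mset_commute)
  qed
next
  case (dia2 \<Sigma> \<Delta> A)
  show ?thesis
    unfolding dia2
  proof (rule ss4_deep1)
    show "ss4 (fill \<Sigma> {#B (\<Delta> + {#F (Dia A)#}), F A#})"
      using assms(2) dia2 by simp
    fix \<Gamma> assume "ss4 (\<Gamma> + {#B (\<Delta> + {#F (Dia A)#}), F A#})"
    then have "ss4 (add_mset (B (add_mset (F (Dia A)) \<Delta>)) (add_mset (F A) \<Gamma>))"
      by (simp add: add_mset_commute)
    then have "ss4 (add_mset (W (add_mset (F A) \<Gamma>)) (add_mset (F (Dia A)) \<Delta>))"
      by (simp only: ss4_residual)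
    then have "ss4 (add_mset (W \<Gamma>) (add_mset (F (Dia A)) \<Delta>))"
      using ss4_ctr[OF ss4_dia[of A \<Gamma> "add_mset (F (Dia A)) \<Delta>", unfolded add_mset_commute[of "W \<Gamma>"]]]
      by (simp add: add_mset_commute)
    then show "ss4 (\<Gamma> + {#B (\<Delta> + {#F (Dia A)#})#})"
      by (simp add: ss4_residual[symmetric])
  qed
qed

lemma ss4_ds4:
  assumes "DS4 ps \<Gamma>" and "\<forall>p \<in> set ps. ss4 p"
  shows "ss4 \<Gamma>"
  using assms
proof cases
  case DKt
  then show ?thesis using assms(2) by (rule ss4_dkt)
next
  case (T_a \<Sigma> A)
  show ?thesis
    unfolding T_a
    by (rule ss4_deep_principal[of "[{#F A#}]"])
      (use assms(2) T_a in \<open>auto intro: ss4_bdia_intro\<close>)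
next
  case (T_b \<Sigma> A)
  show ?thesis
    unfolding T_b
    by (rule ss4_deep_principal[of "[{#F A#}]"])
      (use assms(2) T_b in \<open>auto intro: ss4_dia_intro\<close>)
next
  case (four_a \<Sigma> A \<Delta>)
  show ?thesis
    unfolding four_a
  proof (rule ss4_deep1)
    show "ss4 (fill \<Sigma> {#F (BDia A), B ({#F (BDia A)#} + \<Delta>)#})"
      using assms(2) four_a by simp
    fix \<Gamma> assume "ss4 (\<Gamma> + {#F (BDia A), B ({#F (BDia A)#} + \<Delta>)#})"
    \<comment> \<open>The shallow rule is applied with \<open>BDia A\<close> as its immediate
      subformula; the doubled diamond collapses by \<open>ss4_bdia_bdia\<close>, and contraction
      merges the two copies.\<close>
    then show "ss4 (\<Gamma> + {#F (BDia A), B \<Delta>#})"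
      using ss4_ctr[OF ss4_bdia_bdia[OF ss4_bdia[of "BDia A" \<Delta> "add_mset (F (BDia A)) \<Gamma>",
            unfolded add_mset_commute[of "B \<Delta>"]]]]
      by (simp add: add_mset_commute)
  qed
next
  case (four_b \<Sigma> \<Delta> A)
  show ?thesis
    unfolding four_b
  proof (rule ss4_deep1)
    show "ss4 (fill \<Sigma> {#W (\<Delta> + {#F (BDia A)#}), F (BDia A)#})"
      using assms(2) four_b by simp
    fix \<Gamma> assume "ss4 (\<Gamma> + {#W (\<Delta> + {#F (BDia A)#}), F (BDia A)#})"
    then have "ss4 (add_mset (W (add_mset (F (BDia A)) \<Delta>)) (add_mset (F (BDia A)) \<Gamma>))"
      by (simp add: add_mset_commute)
    then have "ss4 (add_mset (B (add_mset (F (BDia A)) \<Gamma>)) (add_mset (F (BDia A)) \<Delta>))"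
      by (simp only: ss4_residual)
    then have "ss4 (add_mset (B \<Gamma>) (add_mset (F (BDia A)) \<Delta>))"
      using ss4_ctr[OF ss4_bdia_bdia[OF ss4_bdia[of "BDia A" \<Gamma> "add_mset (F (BDia A)) \<Delta>",
            unfolded add_mset_commute[of "B \<Gamma>"]]]]
      by (simp add: add_mset_commute)
    then show "ss4 (\<Gamma> + {#W (\<Delta> + {#F (BDia A)#})#})"
      by (simp add: ss4_residual)
  qed
next
  case (four_c \<Sigma> A \<Delta>)
  show ?thesis
    unfolding four_c
  proof (rule ss4_deep1)
    show "ss4 (fill \<Sigma> {#F (Dia A), W ({#F (Dia A)#} + \<Delta>)#})"
      using assms(2) four_c by simp
    fix \<Gamma> assume "ss4 (\<Gamma> + {#F (Dia A), W ({#F (Dia A)#} + \<Delta>)#})"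
    then show "ss4 (\<Gamma> + {#F (Dia A), W \<Delta>#})"
      using ss4_ctr[OF ss4_dia_dia[OF ss4_dia[of "Dia A" \<Delta> "add_mset (F (Dia A)) \<Gamma>",
            unfolded add_mset_commute[of "W \<Delta>"]]]]
      by (simp add: add_mset_commute)
  qed
next
  case (four_d \<Sigma> \<Delta> A)
  show ?thesis
    unfolding four_d
  proof (rule ss4_deep1)
    show "ss4 (fill \<Sigma> {#B (\<Delta> + {#F (Dia A)#}), F (Dia A)#})"
      using assms(2) four_d by simp
    fix \<Gamma> assume "ss4 (\<Gamma> + {#B (\<Delta> + {#F (Dia A)#}), F (Dia A)#})"
    then have "ss4 (add_mset (B (add_mset (F (Dia A)) \<Delta>)) (add_mset (F (Dia A)) \<Gamma>))"
      by (simp add: add_mset_commute)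
    then have "ss4 (add_mset (W (add_mset (F (Dia A)) \<Gamma>)) (add_mset (F (Dia A)) \<Delta>))"
      by (simp only: ss4_residual)
    then have "ss4 (add_mset (W \<Gamma>) (add_mset (F (Dia A)) \<Delta>))"
      using ss4_ctr[OF ss4_dia_dia[OF ss4_dia[of "Dia A" \<Gamma> "add_mset (F (Dia A)) \<Delta>",
            unfolded add_mset_commute[of "W \<Gamma>"]]]]
      by (simp add: add_mset_commute)
    then show "ss4 (\<Gamma> + {#B (\<Delta> + {#F (Dia A)#})#})"
      by (simp add: ss4_residual[symmetric])
  qed
qed

lemma ss4_if_ds4: "derivable DS4 \<Gamma> \<Longrightarrow> ss4 \<Gamma>"
  by (induction rule: derivable.induct) (auto intro: ss4_ds4)

section \<open>Kripke semantics\<close>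

primrec sat :: "('w \<times> 'w) set \<Rightarrow> ('w \<Rightarrow> 'a \<Rightarrow> bool) \<Rightarrow> 'a fm \<Rightarrow> 'w \<Rightarrow> bool" where
  "sat R V (Atom a) w = V w a"
| "sat R V (NegAtom a) w = (\<not> V w a)"
| "sat R V (Or A C) w = (sat R V A w \<or> sat R V C w)"
| "sat R V (And A C) w = (sat R V A w \<and> sat R V C w)"
| "sat R V (Box A) w = (\<forall>v. (w, v) \<in> R \<longrightarrow> sat R V A v)"
| "sat R V (BBox A) w = (\<forall>v. (v, w) \<in> R \<longrightarrow> sat R V A v)"
| "sat R V (Dia A) w = (\<exists>v. (w, v) \<in> R \<and> sat R V A v)"
| "sat R V (BDia A) w = (\<exists>v. (v, w) \<in> R \<and> sat R V A v)"

text \<open>Recursion through multisets has to go through \<open>image_mset\<close>;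
  \<open>isat_simps\<close> replaces these equations by ones that mention \<open>ssat\<close>. A
  sequent is read as a disjunction.\<close>

primrec isat :: "('w \<times> 'w) set \<Rightarrow> ('w \<Rightarrow> 'a \<Rightarrow> bool) \<Rightarrow> 'a item \<Rightarrow> 'w \<Rightarrow> bool" where
  "isat R V (F A) = sat R V A"
| "isat R V (W \<Delta>) = (\<lambda>w. \<forall>v. (w, v) \<in> R \<longrightarrow> (\<exists>f \<in># image_mset (isat R V) \<Delta>. f v))"
| "isat R V (B \<Delta>) = (\<lambda>w. \<forall>v. (v, w) \<in> R \<longrightarrow> (\<exists>f \<in># image_mset (isat R V) \<Delta>. f v))"

definition ssat :: "('w \<times> 'w) set \<Rightarrow> ('w \<Rightarrow> 'a \<Rightarrow> bool) \<Rightarrow> 'a seq \<Rightarrow> 'w \<Rightarrow> bool" where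
  "ssat R V \<Gamma> w \<longleftrightarrow> (\<exists>X \<in># \<Gamma>. isat R V X w)"

lemma isat_simps [simp]:
  "isat R V (W \<Delta>) w \<longleftrightarrow> (\<forall>v. (w, v) \<in> R \<longrightarrow> ssat R V \<Delta> v)"
  "isat R V (B \<Delta>) w \<longleftrightarrow> (\<forall>v. (v, w) \<in> R \<longrightarrow> ssat R V \<Delta> v)"
  by (auto simp: ssat_def)

declare isat.simps(2,3) [simp del]

lemma ssat_simps [simp]:
  "\<not> ssat R V {#} w"
  "ssat R V (add_mset X \<Gamma>) w \<longleftrightarrow> isat R V X w \<or> ssat R V \<Gamma> w"
  "ssat R V (\<Gamma> + \<Delta>) w \<longleftrightarrow> ssat R V \<Gamma> w \<or> ssat R V \<Delta> w"
  by (auto simp: ssat_def)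

lemma sat_neg [simp]: "sat R V (neg A) w \<longleftrightarrow> \<not> sat R V A w"
  by (induction A arbitrary: w) auto

text \<open>The premises are assumed at all worlds because \<open>rf\<close> and \<open>rp\<close>
  use theirs at a predecessor or a successor of the world of the conclusion.\<close>

lemma skt_sound:
  assumes "SKt ps \<Gamma>" and "\<forall>p \<in> set ps. \<forall>w. ssat R V p w"
  shows "ssat R V \<Gamma> w"
  using assms by cases fastforce+

lemma ss4_sound:
  assumes "ss4 \<Gamma>" and "refl R" and "trans R"
  shows "ssat R V \<Gamma> w"
  using assms(1)
proof (induction arbitrary: w rule: derivable.induct)
  case (infer ps \<Gamma>)
  then have *: "\<forall>p \<in> set ps. \<forall>w. ssat R V p w"
    by blast
  from infer(1) show ?case
  proof cases
    case SKt
    then show ?thesis using * by (rule skt_sound)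
  next
    case (T_f \<Gamma>' \<Delta>)
    then show ?thesis using * assms(2) by (auto dest: reflD)
  next
    case (four_f \<Gamma>' \<Delta>)
    then show ?thesis using * assms(3) by (auto dest: transD)
  qed
qed

section \<open>A labelled refutation calculus\<close>

text \<open>
  \<open>Wit x (Box A)\<close> is a Henkin witness for the failure of \<open>Box A\<close> at \<open>x\<close>. Naming the witness
  replaces the freshness condition of the box rules, so that weakening is immediate.
\<close>

datatype 'a lbl = Pos "nat list" | Wit "'a lbl" "'a fm"

text \<open>\<open>Lab x A\<close> says that \<open>A\<close> is false at \<open>x\<close>.\<close>

datatype 'a fact = Lab "'a lbl" "'a fm" | Edge "'a lbl" "'a lbl"

text \<open>The empty default lets one rule \<open>wit\<close> serve both boxes; for any other
  formula that rule merely repeats its conclusion.\<close>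

fun wfacts :: "'a lbl \<Rightarrow> 'a fm \<Rightarrow> 'a fact set" where
  "wfacts x (Box A) = {Edge x (Wit x (Box A)), Lab (Wit x (Box A)) A}"
| "wfacts x (BBox A) = {Edge (Wit x (BBox A)) x, Lab (Wit x (BBox A)) A}"
| "wfacts x _ = {}"

definition reach :: "'a fact set \<Rightarrow> ('a lbl \<times> 'a lbl) set" where
  "reach S = {(x, y). Edge x y \<in> S}\<^sup>*"

inductive refut :: "'a fact set \<Rightarrow> bool" where
  id: "Lab x (Atom a) \<in> S \<Longrightarrow> Lab x (NegAtom a) \<in> S \<Longrightarrow> refut S"
| conj: "Lab x (And A C) \<in> S \<Longrightarrow> refut (insert (Lab x A) S) \<Longrightarrow> refut (insert (Lab x C) S) \<Longrightarrow> refut S"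
| disj: "Lab x (Or A C) \<in> S \<Longrightarrow> refut (insert (Lab x A) (insert (Lab x C) S)) \<Longrightarrow> refut S"
| wit: "Lab x A \<in> S \<Longrightarrow> refut (S \<union> wfacts x A) \<Longrightarrow> refut S"
| dia: "Lab x (Dia A) \<in> S \<Longrightarrow> (x, y) \<in> reach S \<Longrightarrow> refut (insert (Lab y A) S) \<Longrightarrow> refut S"
| bdia: "Lab x (BDia A) \<in> S \<Longrightarrow> (y, x) \<in> reach S \<Longrightarrow> refut (insert (Lab y A) S) \<Longrightarrow> refut S"

lemma reach_mono: "S \<subseteq> S' \<Longrightarrow> reach S \<subseteq> reach S'"
  unfolding reach_def by (rule rtrancl_mono) blast

lemma reach_finite:
  assumes "(x, y) \<in> reach S"
  shows "\<exists>G \<subseteq> S. finite G \<and> (x, y) \<in> reach G"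
  using assms unfolding reach_def
proof (induction rule: rtrancl_induct)
  case base
  then show ?case by blast
next
  case (step y z)
  then obtain G where G: "G \<subseteq> S" "finite G" "(x, y) \<in> reach G"
    unfolding reach_def by blast
  have "(x, y) \<in> reach (insert (Edge y z) G)"
    using G(3) reach_mono[of G "insert (Edge y z) G"] by blast
  then have "(x, z) \<in> reach (insert (Edge y z) G)"
    unfolding reach_def by (rule rtrancl_into_rtrancl) simp
  then show ?case
    using G step(2) unfolding reach_def by (intro exI[of _ "insert (Edge y z) G"]) auto
qed

lemma refut_mono: "refut S \<Longrightarrow> S \<subseteq> S' \<Longrightarrow> refut S'"
proof (induction arbitrary: S' rule: refut.induct)
  case (id x a S)
  then show ?case using refut.id[of x a S'] by blast
next
  case (conj x A C S)
  show ?case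
    by (rule refut.conj[of x A C S'])
      (use conj.hyps(1) conj.prems conj.IH(1)[of "insert (Lab x A) S'"] conj.IH(2)[of "insert (Lab x C) S'"] in blast)+
next
  case (disj x A C S)
  show ?case
    by (rule refut.disj[of x A C S'])
      (use disj.hyps(1) disj.prems disj.IH[of "insert (Lab x A) (insert (Lab x C) S')"] in blast)+
next
  case (wit x A S)
  show ?case
    by (rule refut.wit[of x A S'])
      (use wit.hyps(1) wit.prems wit.IH[of "S' \<union> wfacts x A"] in blast)+
next
  case (dia x A S y)
  show ?case
    by (rule refut.dia[of x A S' y])
      (use dia.hyps(1,2) dia.prems dia.IH[of "insert (Lab y A) S'"] reach_mono[of S S'] in blast)+
next
  case (bdia x A S y)
  show ?case
    by (rule refut.bdia[of x A S' y])
      (use bdia.hyps(1,2) bdia.prems bdia.IH[of "insert (Lab y A) S'"] reach_mono[of S S'] in blast)+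
qed

section \<open>Finitary character and maximal irrefutable sets\<close>

lemma refut_finite_part:
  assumes "\<exists>G \<subseteq> X \<union> S. finite G \<and> refut G"
  obtains K where "K \<subseteq> S" and "finite K" and "\<And>L. K \<subseteq> L \<Longrightarrow> refut (X \<union> L)"
proof -
  obtain G where G: "G \<subseteq> X \<union> S" "finite G" "refut G"
    using assms by blast
  show thesis
  proof
    show "G - X \<subseteq> S" "finite (G - X)"
      using G by auto
    show "refut (X \<union> L)" if "G - X \<subseteq> L" for L
      using that by (intro refut_mono[OF G(3)]) blast
  qed
qed

text \<open>Each step inspects one or two labelled formulae and at most one path, which is finite.
  The finite parts of the premises are joined and completed by the principal fact and the edges of
  that path.\<close>

lemma refut_finite: "refut S \<Longrightarrow> \<exists>G \<subseteq> S. finite G \<and> refut G"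
proof (induction rule: refut.induct)
  case (id x a S)
  then show ?case
    by (intro exI[of _ "{Lab x (Atom a), Lab x (NegAtom a)}"]) (auto intro: refut.id)
next
  case (conj x A C S)
  obtain G where G: "G \<subseteq> S" "finite G" "\<And>L. G \<subseteq> L \<Longrightarrow> refut ({Lab x A} \<union> L)"
    using refut_finite_part[of "{Lab x A}" S] conj.IH(1) by auto
  obtain H where H: "H \<subseteq> S" "finite H" "\<And>L. H \<subseteq> L \<Longrightarrow> refut ({Lab x C} \<union> L)"
    using refut_finite_part[of "{Lab x C}" S] conj.IH(2) by auto
  let ?K = "insert (Lab x (And A C)) (G \<union> H)"
  have *: "refut ({Lab x A} \<union> ?K)" "refut ({Lab x C} \<union> ?K)"
    by (rule G(3), blast) (rule H(3), blast)
  have "refut ?K"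
    by (rule refut.conj[of x A C]) (use * in \<open>simp_all add: insert_commute\<close>)
  then show ?case
    using G H conj.hyps by (intro exI[of _ ?K]) simp
next
  case (disj x A C S)
  obtain G where G: "G \<subseteq> S" "finite G" "\<And>L. G \<subseteq> L \<Longrightarrow> refut ({Lab x A, Lab x C} \<union> L)"
    using refut_finite_part[of "{Lab x A, Lab x C}" S] disj.IH by auto
  let ?K = "insert (Lab x (Or A C)) G"
  have *: "refut ({Lab x A, Lab x C} \<union> ?K)"
    by (rule G(3)) blast
  have "refut ?K"
    by (rule refut.disj[of x A C]) (use * in \<open>simp_all add: insert_commute\<close>)
  then show ?case
    using G disj.hyps by (intro exI[of _ ?K]) simp
next
  case (wit x A S)
  obtain G where G: "G \<subseteq> S" "finite G" "\<And>L. G \<subseteq> L \<Longrightarrow> refut (wfacts x A \<union> L)"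
    using refut_finite_part[of "wfacts x A" S] wit.IH by (auto simp: Un_commute)
  let ?K = "insert (Lab x A) G"
  have *: "refut (wfacts x A \<union> ?K)"
    by (rule G(3)) blast
  have "refut ?K"
    by (rule refut.wit[of x A]) (use * in \<open>simp_all add: Un_commute\<close>)
  then show ?case
    using G wit.hyps by (intro exI[of _ ?K]) simp
next
  case (dia x A S y)
  obtain G where G: "G \<subseteq> S" "finite G" "\<And>L. G \<subseteq> L \<Longrightarrow> refut ({Lab y A} \<union> L)"
    using refut_finite_part[of "{Lab y A}" S] dia.IH by auto
  obtain H where H: "H \<subseteq> S" "finite H" "(x, y) \<in> reach H"
    using reach_finite[OF dia.hyps(2)] by blast
  let ?K = "insert (Lab x (Dia A)) (G \<union> H)"
  have *: "refut ({Lab y A} \<union> ?K)" "(x, y) \<in> reach ?K"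
    by (rule G(3), blast) (use H(3) reach_mono[of H ?K] in blast)
  have "refut ?K"
    by (rule refut.dia[of x A _ y]) (use * in \<open>simp_all add: insert_commute\<close>)
  then show ?case
    using G H dia.hyps by (intro exI[of _ ?K]) simp
next
  case (bdia x A S y)
  obtain G where G: "G \<subseteq> S" "finite G" "\<And>L. G \<subseteq> L \<Longrightarrow> refut ({Lab y A} \<union> L)"
    using refut_finite_part[of "{Lab y A}" S] bdia.IH by auto
  obtain H where H: "H \<subseteq> S" "finite H" "(y, x) \<in> reach H"
    using reach_finite[OF bdia.hyps(2)] by blast
  let ?K = "insert (Lab x (BDia A)) (G \<union> H)"
  have *: "refut ({Lab y A} \<union> ?K)" "(y, x) \<in> reach ?K"
    by (rule G(3), blast) (use H(3) reach_mono[of H ?K] in blast)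
  have "refut ?K"
    by (rule refut.bdia[of x A _ y]) (use * in \<open>simp_all add: insert_commute\<close>)
  then show ?case
    using G H bdia.hyps by (intro exI[of _ ?K]) simp
qed

lemma refut_maximal:
  assumes "\<not> refut S"
  obtains M where "S \<subseteq> M" and "\<not> refut M" and "\<And>X. M \<subseteq> X \<Longrightarrow> \<not> refut X \<Longrightarrow> X = M"
proof -
  let ?\<A> = "{X. S \<subseteq> X \<and> \<not> refut X}"
  have "\<exists>M \<in> ?\<A>. \<forall>X \<in> ?\<A>. M \<subseteq> X \<longrightarrow> X = M"
  proof (rule subset_Zorn_nonempty)
    show "?\<A> \<noteq> {}" using assms by blast
    fix \<C> assume \<C>: "\<C> \<noteq> {}" "subset.chain ?\<A> \<C>"
    have "\<not> refut (\<Union>\<C>)"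
    proof
      assume "refut (\<Union>\<C>)"
      then obtain G where G: "G \<subseteq> \<Union>\<C>" "finite G" "refut G"
        using refut_finite by blast
      \<comment> \<open>A finite part of the union already lies in one member of the chain, which
        would then be refutable.\<close>
      then obtain X where "X \<in> \<C>" "G \<subseteq> X"
        using \<C> finite_subset_Union_chain by metis
      then show False
        using \<C>(2) refut_mono[OF G(3)] unfolding subset_chain_def by blast
    qed
    then show "\<Union>\<C> \<in> ?\<A>"
      using \<C> unfolding subset_chain_def by blast
  qed
  then obtain M where M: "M \<in> ?\<A>" "\<forall>X \<in> ?\<A>. M \<subseteq> X \<longrightarrow> X = M"
    by (rule bexE)
  show thesis
  proof (rule that)
    show "S \<subseteq> M" "\<not> refut M"
      using M(1) by blast+
    show "X = M" if "M \<subseteq> X" "\<not> refut X" for X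
    proof -
      have "X \<in> ?\<A>"
        using M(1) that by blast
      then show ?thesis
        using M(2) that(1) by blast
    qed
  qed
qed

text \<open>Read backwards, each rule says that some premise is irrefutable, and maximality then
  puts the facts of that premise into \<open>M\<close>. Atoms are true unless declared false, so
  \<open>refut.id\<close> is what settles negated atoms.\<close>

lemma maximal_falsified:
  assumes "\<not> refut M" and max: "\<And>X. M \<subseteq> X \<Longrightarrow> \<not> refut X \<Longrightarrow> X = M"
    and "Lab x A \<in> M"
  shows "\<not> sat (reach M) (\<lambda>x a. Lab x (Atom a) \<notin> M) A x"
  using assms(3)
proof (induction A arbitrary: x)
  case (Atom a)
  then show ?case by simp
next
  case (NegAtom a)
  then show ?case using assms(1) refut.id[of x a M] by auto
next
  case (Or A C)
  then have "\<not> refut (insert (Lab x A) (insert (Lab x C) M))"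
    using assms(1) refut.disj[of x A C M] by blast
  then have "Lab x A \<in> M" "Lab x C \<in> M"
    using max[of "insert (Lab x A) (insert (Lab x C) M)"] by blast+
  then show ?case using Or.IH by simp
next
  case (And A C)
  then have "\<not> refut (insert (Lab x A) M) \<or> \<not> refut (insert (Lab x C) M)"
    using assms(1) refut.conj[of x A C M] by blast
  then have "Lab x A \<in> M \<or> Lab x C \<in> M"
    using max[of "insert (Lab x A) M"] max[of "insert (Lab x C) M"] by blast
  then show ?case using And.IH by auto
next
  case (Box A)
  then have "wfacts x (Box A) \<subseteq> M"
    using assms(1) refut.wit[of x "Box A" M] max[of "M \<union> wfacts x (Box A)"] by blast
  then have "(x, Wit x (Box A)) \<in> reach M" "Lab (Wit x (Box A)) A \<in> M"
    unfolding reach_def by (auto intro: r_into_rtrancl)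
  then show ?case using Box.IH by auto
next
  case (BBox A)
  then have "wfacts x (BBox A) \<subseteq> M"
    using assms(1) refut.wit[of x "BBox A" M] max[of "M \<union> wfacts x (BBox A)"] by blast
  then have "(Wit x (BBox A), x) \<in> reach M" "Lab (Wit x (BBox A)) A \<in> M"
    unfolding reach_def by (auto intro: r_into_rtrancl)
  then show ?case using BBox.IH by auto
next
  case (Dia A)
  have "Lab y A \<in> M" if "(x, y) \<in> reach M" for y
    using that Dia.prems assms(1) refut.dia[of x A M y] max[of "insert (Lab y A) M"] by blast
  then show ?case using Dia.IH by auto
next
  case (BDia A)
  have "Lab y A \<in> M" if "(y, x) \<in> reach M" for y
    using that BDia.prems assms(1) refut.bdia[of x A M y] max[of "insert (Lab y A) M"] by blast
  then show ?case using BDia.IH by auto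
qed

section \<open>Ordered nested sequents\<close>

text \<open>
  Ordering the children gives every node an address, and an address stays valid when formulae and
  new last children are added. The flag \<open>white\<close> is the colour of the structure formed by the tree;
  it is irrelevant at the root.
\<close>

datatype 'a ntree = Node (white: bool) (fms: "'a fm list") (kids: "'a ntree list")

primrec itemt :: "'a ntree \<Rightarrow> 'a item" where
  "itemt (Node c As ts) = (if c then W else B) (mset (map F As) + mset (map itemt ts))"

definition seqt :: "'a ntree \<Rightarrow> 'a seq" where
  "seqt t = mset (map F (fms t)) + mset (map itemt (kids t))"

lemma itemt_eq: "itemt t = (if white t then W else B) (seqt t)"
  by (cases t) (simp add: seqt_def)

text \<open>The assumption on single members is exactly what the induction hypothesis in
  \<open>itemt_surj\<close> provides.\<close>

lemma seqt_surj_if: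
  assumes "\<And>X. X \<in># \<Gamma> \<Longrightarrow> (\<exists>A. X = F A) \<or> (\<exists>t. X = itemt t)"
  shows "\<exists>t. white t = c \<and> seqt t = \<Gamma>"
  using assms
proof (induction \<Gamma>)
  case empty
  then show ?case by (intro exI[of _ "Node c [] []"]) (simp add: seqt_def)
next
  case (add X \<Gamma>)
  then obtain t where t: "white t = c" "seqt t = \<Gamma>"
    by auto
  from add.prems[of X] consider A where "X = F A" | u where "X = itemt u"
    by auto
  then show ?case
  proof cases
    case 1
    then show ?thesis
      using t by (intro exI[of _ "Node c (A # fms t) (kids t)"]) (auto simp: seqt_def)
  next
    case 2
    then show ?thesis
      using t by (intro exI[of _ "Node c (fms t) (u # kids t)"]) (auto simp: seqt_def)
  qed
qed

lemma itemt_surj: "(\<exists>A. X = F A) \<or> (\<exists>t. X = itemt t)"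
proof (induction X)
  case (F A)
  then show ?case by simp
next
  case (W \<Delta>)
  obtain t where "white t" "seqt t = \<Delta>"
    using seqt_surj_if[of \<Delta> True] W by auto
  then show ?case by (intro disjI2 exI[of _ t]) (simp add: itemt_eq)
next
  case (B \<Delta>)
  obtain t where "\<not> white t" "seqt t = \<Delta>"
    using seqt_surj_if[of \<Delta> False] B by auto
  then show ?case by (intro disjI2 exI[of _ t]) (simp add: itemt_eq)
qed

lemma seqt_surj: "\<exists>t. seqt t = \<Gamma>"
  using seqt_surj_if[OF itemt_surj] by blast

section \<open>Addresses, local updates and growth of trees\<close>

primrec valid :: "nat list \<Rightarrow> 'a ntree \<Rightarrow> bool" where
  "valid [] t = True"
| "valid (i # p) t = (i < length (kids t) \<and> valid p (kids t ! i))"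

primrec sub :: "nat list \<Rightarrow> 'a ntree \<Rightarrow> 'a ntree" where
  "sub [] t = t"
| "sub (i # p) t = sub p (kids t ! i)"

primrec upd :: "('a ntree \<Rightarrow> 'a ntree) \<Rightarrow> nat list \<Rightarrow> 'a ntree \<Rightarrow> 'a ntree" where
  "upd h [] t = h t"
| "upd h (i # p) t = Node (white t) (fms t) ((kids t)[i := upd h p (kids t ! i)])"

text \<open>This is the accessibility direction: a white child is a successor of its parent, a black
  child a predecessor.\<close>

definition edges :: "'a ntree \<Rightarrow> (nat list \<times> nat list) set" where
  "edges t = {(p, p @ [i]) | p i. valid (p @ [i]) t \<and> white (sub (p @ [i]) t)} \<union>
    {(p @ [i], p) | p i. valid (p @ [i]) t \<and> \<not> white (sub (p @ [i]) t)}"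

definition ext :: "'a ntree \<Rightarrow> 'a ntree \<Rightarrow> bool" where
  "ext t u \<longleftrightarrow> (\<forall>p. valid p t \<longrightarrow> valid p u \<and> white (sub p u) = white (sub p t) \<and>
    set (fms (sub p t)) \<subseteq> set (fms (sub p u)))"

definition addf :: "'a fm \<Rightarrow> 'a ntree \<Rightarrow> 'a ntree" where
  "addf A t = Node (white t) (A # fms t) (kids t)"

definition addk :: "'a ntree \<Rightarrow> 'a ntree \<Rightarrow> 'a ntree" where
  "addk k t = Node (white t) (fms t) (kids t @ [k])"

lemma addf_sel [simp]:
  "white (addf A t) = white t" "fms (addf A t) = A # fms t" "kids (addf A t) = kids t"
  "seqt (addf A t) = add_mset (F A) (seqt t)"
  by (simp_all add: addf_def seqt_def)

lemma addk_sel [simp]: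
  "white (addk k t) = white t" "fms (addk k t) = fms t" "kids (addk k t) = kids t @ [k]"
  "seqt (addk k t) = add_mset (itemt k) (seqt t)"
  by (simp_all add: addk_def seqt_def)

lemma valid_append [simp]: "valid (p @ q) t \<longleftrightarrow> valid p t \<and> valid q (sub p t)"
  by (induction p arbitrary: t) auto

lemma sub_append [simp]: "sub (p @ q) t = sub q (sub p t)"
  by (induction p arbitrary: t) auto

lemma upd_append: "upd h (p @ q) t = upd (upd h q) p t"
  by (induction p arbitrary: t) auto

lemma sub_upd [simp]: "valid p t \<Longrightarrow> sub p (upd h p t) = h (sub p t)"
  by (induction p arbitrary: t) auto

lemma white_upd [simp]:
  "white (h (sub p t)) = white (sub p t) \<Longrightarrow> white (upd h p t) = white t"
  by (cases p) auto

lemma ext_refl: "ext t t"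
  by (simp add: ext_def)

lemma ext_trans: "ext t u \<Longrightarrow> ext u v \<Longrightarrow> ext t v"
  unfolding ext_def by blast

lemma ext_edges: "ext t u \<Longrightarrow> edges t \<subseteq> edges u"
  unfolding ext_def edges_def by blast

lemma ext_upd: "valid p t \<Longrightarrow> ext (sub p t) (h (sub p t)) \<Longrightarrow> ext t (upd h p t)"
proof (induction p arbitrary: t)
  case Nil
  then show ?case by simp
next
  case (Cons i p)
  then have i: "i < length (kids t)" and *: "ext (kids t ! i) (upd h p (kids t ! i))"
    by simp_all
  show ?case
    unfolding ext_def
  proof (intro allI impI)
    fix q assume "valid q t"
    then show "valid q (upd h (i # p) t) \<and> white (sub q (upd h (i # p) t)) = white (sub q t) \<and>
        set (fms (sub q t)) \<subseteq> set (fms (sub q (upd h (i # p) t)))"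
      using i * unfolding ext_def by (cases q) (auto simp: nth_list_update)
  qed
qed

lemma ext_addf: "ext t (addf A t)"
  unfolding ext_def
proof (intro allI)
  fix p show "valid p t \<longrightarrow> valid p (addf A t) \<and> white (sub p (addf A t)) = white (sub p t) \<and>
      set (fms (sub p t)) \<subseteq> set (fms (sub p (addf A t)))"
    by (cases p) auto
qed

lemma ext_addk: "ext t (addk k t)"
  unfolding ext_def
proof (intro allI)
  fix p show "valid p t \<longrightarrow> valid p (addk k t) \<and> white (sub p (addk k t)) = white (sub p t) \<and>
      set (fms (sub p t)) \<subseteq> set (fms (sub p (addk k t)))"
    by (cases p) (auto simp: nth_append)
qed

lemma edges_valid: "(p, q) \<in> edges t \<Longrightarrow> valid p t \<and> valid q t"
  unfolding edges_def by auto

text \<open>Adding the old child on one side and the new one on the other avoids multiset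
  subtraction.\<close>

lemma seqt_kid:
  assumes "i < length (kids t)"
  shows "seqt (upd h [i] t) + {#itemt (kids t ! i)#} = seqt t + {#itemt (h (kids t ! i))#}"
proof -
  have "itemt (kids t ! i) \<in># mset (map itemt (kids t))"
    using assms by simp
  then show ?thesis
    using assms by (simp add: seqt_def map_update mset_update del: mset_map)
qed

text \<open>The context is chosen before \<open>h\<close>, so one \<Sigma> serves the conclusion and
  all premises of a deep rule. The balance equation expresses that \<open>h\<close> exchanges
  \<Theta> for \<Theta>' at the node.\<close>

lemma upd_fill:
  assumes "valid p t" and "\<Theta> \<subseteq># seqt (sub p t)"
  shows "\<exists>\<Sigma>. seqt t = fill \<Sigma> \<Theta> \<and> (\<forall>h \<Theta>'. white (h (sub p t)) = white (sub p t) \<longrightarrow>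
    seqt (h (sub p t)) + \<Theta> = seqt (sub p t) + \<Theta>' \<longrightarrow> seqt (upd h p t) = fill \<Sigma> \<Theta>')"
  using assms
proof (induction p arbitrary: t)
  case Nil
  then obtain \<Delta> where \<Delta>: "seqt t = \<Delta> + \<Theta>"
    by (metis sub.simps(1) subset_mset.diff_add)
  then show ?case
    by (intro exI[of _ "Hole \<Delta>"]) (auto simp: ac_simps)
next
  case (Cons i p)
  let ?k = "kids t ! i"
  obtain \<Sigma> where \<Sigma>: "seqt ?k = fill \<Sigma> \<Theta>"
    "\<And>h \<Theta>'. white (h (sub p ?k)) = white (sub p ?k) \<Longrightarrow>
      seqt (h (sub p ?k)) + \<Theta> = seqt (sub p ?k) + \<Theta>' \<Longrightarrow> seqt (upd h p ?k) = fill \<Sigma> \<Theta>'"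
    using Cons.IH[of ?k] Cons.prems by auto
  have i: "i < length (kids t)"
    using Cons.prems by simp
  define \<Delta> where "\<Delta> = seqt t - {#itemt ?k#}"
  have "itemt ?k \<in># seqt t"
    using i by (simp add: seqt_def)
  then have \<Delta>: "seqt t = \<Delta> + {#itemt ?k#}"
    by (simp add: \<Delta>_def)
  have upd: "seqt (upd h (i # p) t) = \<Delta> + {#itemt (upd h p ?k)#}" for h
  proof -
    have "seqt (upd h (i # p) t) = seqt (upd (upd h p) [i] t)"
      by simp
    then show ?thesis
      using seqt_kid[OF i, of "upd h p"] \<Delta> by simp
  qed
  show ?case
  proof (intro exI conjI allI impI)
    let ?\<Sigma> = "(if white ?k then WCtx else BCtx) \<Delta> \<Sigma>"
    show "seqt t = fill ?\<Sigma> \<Theta>"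
      using \<Delta> \<Sigma>(1) itemt_eq[of ?k] by simp
    fix h \<Theta>'
    assume "white (h (sub (i # p) t)) = white (sub (i # p) t)"
      and "seqt (h (sub (i # p) t)) + \<Theta> = seqt (sub (i # p) t) + \<Theta>'"
    then show "seqt (upd h (i # p) t) = fill ?\<Sigma> \<Theta>'"
      unfolding upd using \<Sigma>(2)[of h \<Theta>'] itemt_eq[of "upd h p ?k"] by simp
  qed
qed

lemma node_fill:
  assumes "valid p t" and "X \<in># seqt (sub p t)"
  obtains \<Sigma> where "seqt t = fill \<Sigma> {#X#}"
    and "\<And>h \<Theta>. white (h (sub p t)) = white (sub p t) \<Longrightarrow>
      seqt (h (sub p t)) = seqt (sub p t) + \<Theta> \<Longrightarrow> seqt (upd h p t) = fill \<Sigma> (add_mset X \<Theta>)"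
  using upd_fill[of p t "{#X#}"] assms by auto

lemma formula_in_seqt: "A \<in> set (fms t) \<Longrightarrow> F A \<in># seqt t"
  by (simp add: seqt_def)

section \<open>Deep inference on ordered nested sequents\<close>

abbreviation ds4t :: "'a ntree \<Rightarrow> bool" where
  "ds4t t \<equiv> derivable DS4 (seqt t)"

lemma ds4t_id:
  assumes "valid p t" and "Atom a \<in> set (fms (sub p t))" and "NegAtom a \<in> set (fms (sub p t))"
  shows "ds4t t"
proof -
  have "{#F (Atom a), F (NegAtom a)#} \<subseteq># seqt (sub p t)"
    using assms(2,3) by (simp add: formula_in_seqt insert_subset_eq_iff in_diff_count)
  then obtain \<Sigma> where "seqt t = fill \<Sigma> {#F (Atom a), F (NegAtom a)#}"
    using upd_fill[OF assms(1)] by blast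
  then show ?thesis
    using derivable.infer[of DS4 "[]", OF DS4.DKt[OF DKt.id]] by simp
qed

lemma ds4t_conj:
  assumes "valid p t" and "And A C \<in> set (fms (sub p t))"
    and "ds4t (upd (addf A) p t)" and "ds4t (upd (addf C) p t)"
  shows "ds4t t"
proof -
  obtain \<Sigma> where \<Sigma>: "seqt t = fill \<Sigma> {#F (And A C)#}"
    "\<And>h \<Theta>. white (h (sub p t)) = white (sub p t) \<Longrightarrow>
      seqt (h (sub p t)) = seqt (sub p t) + \<Theta> \<Longrightarrow> seqt (upd h p t) = fill \<Sigma> (add_mset (F (And A C)) \<Theta>)"
    using node_fill[OF assms(1) formula_in_seqt[OF assms(2)]] by blast
  show ?thesis
    using derivable2[of DS4, OF DS4.DKt[OF DKt.conj[of \<Sigma> A C]]] assms(3,4) \<Sigma>(1)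
      \<Sigma>(2)[of "addf A" "{#F A#}"] \<Sigma>(2)[of "addf C" "{#F C#}"]
    by simp
qed

lemma ds4t_disj:
  assumes "valid p t" and "Or A C \<in> set (fms (sub p t))"
    and "ds4t (upd (addf A \<circ> addf C) p t)"
  shows "ds4t t"
proof -
  obtain \<Sigma> where \<Sigma>: "seqt t = fill \<Sigma> {#F (Or A C)#}"
    "\<And>h \<Theta>. white (h (sub p t)) = white (sub p t) \<Longrightarrow>
      seqt (h (sub p t)) = seqt (sub p t) + \<Theta> \<Longrightarrow> seqt (upd h p t) = fill \<Sigma> (add_mset (F (Or A C)) \<Theta>)"
    using node_fill[OF assms(1) formula_in_seqt[OF assms(2)]] by blast
  show ?thesis
    using derivable1[of DS4, OF DS4.DKt[OF DKt.disj[of \<Sigma> A C]]] assms(3) \<Sigma>(1)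
      \<Sigma>(2)[of "addf A \<circ> addf C" "{#F A, F C#}"]
    by simp
qed

lemma ds4t_box:
  assumes "valid p t" and "Box A \<in> set (fms (sub p t))"
    and "ds4t (upd (addk (Node True [A] [])) p t)"
  shows "ds4t t"
proof -
  obtain \<Sigma> where \<Sigma>: "seqt t = fill \<Sigma> {#F (Box A)#}"
    "\<And>h \<Theta>. white (h (sub p t)) = white (sub p t) \<Longrightarrow>
      seqt (h (sub p t)) = seqt (sub p t) + \<Theta> \<Longrightarrow> seqt (upd h p t) = fill \<Sigma> (add_mset (F (Box A)) \<Theta>)"
    using node_fill[OF assms(1) formula_in_seqt[OF assms(2)]] by blast
  show ?thesis
    using derivable1[of DS4, OF DS4.DKt[OF DKt.box[of \<Sigma> A]]] assms(3) \<Sigma>(1)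
      \<Sigma>(2)[of "addk (Node True [A] [])" "{#W {#F A#}#}"]
    by simp
qed

lemma ds4t_bbox:
  assumes "valid p t" and "BBox A \<in> set (fms (sub p t))"
    and "ds4t (upd (addk (Node False [A] [])) p t)"
  shows "ds4t t"
proof -
  obtain \<Sigma> where \<Sigma>: "seqt t = fill \<Sigma> {#F (BBox A)#}"
    "\<And>h \<Theta>. white (h (sub p t)) = white (sub p t) \<Longrightarrow>
      seqt (h (sub p t)) = seqt (sub p t) + \<Theta> \<Longrightarrow> seqt (upd h p t) = fill \<Sigma> (add_mset (F (BBox A)) \<Theta>)"
    using node_fill[OF assms(1) formula_in_seqt[OF assms(2)]] by blast
  show ?thesis
    using derivable1[of DS4, OF DS4.DKt[OF DKt.bbox[of \<Sigma> A]]] assms(3) \<Sigma>(1)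
      \<Sigma>(2)[of "addk (Node False [A] [])" "{#B {#F A#}#}"]
    by simp
qed

lemma ds4t_dia_T:
  assumes "valid p t" and "Dia A \<in> set (fms (sub p t))" and "ds4t (upd (addf A) p t)"
  shows "ds4t t"
proof -
  obtain \<Sigma> where \<Sigma>: "seqt t = fill \<Sigma> {#F (Dia A)#}"
    "\<And>h \<Theta>. white (h (sub p t)) = white (sub p t) \<Longrightarrow>
      seqt (h (sub p t)) = seqt (sub p t) + \<Theta> \<Longrightarrow> seqt (upd h p t) = fill \<Sigma> (add_mset (F (Dia A)) \<Theta>)"
    using node_fill[OF assms(1) formula_in_seqt[OF assms(2)]] by blast
  show ?thesis
    using derivable1[of DS4, OF DS4.T_b[of \<Sigma> A]] assms(3) \<Sigma>(1) \<Sigma>(2)[of "addf A" "{#F A#}"]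
    by simp
qed

lemma ds4t_bdia_T:
  assumes "valid p t" and "BDia A \<in> set (fms (sub p t))" and "ds4t (upd (addf A) p t)"
  shows "ds4t t"
proof -
  obtain \<Sigma> where \<Sigma>: "seqt t = fill \<Sigma> {#F (BDia A)#}"
    "\<And>h \<Theta>. white (h (sub p t)) = white (sub p t) \<Longrightarrow>
      seqt (h (sub p t)) = seqt (sub p t) + \<Theta> \<Longrightarrow> seqt (upd h p t) = fill \<Sigma> (add_mset (F (BDia A)) \<Theta>)"
    using node_fill[OF assms(1) formula_in_seqt[OF assms(2)]] by blast
  show ?thesis
    using derivable1[of DS4, OF DS4.T_a[of \<Sigma> A]] assms(3) \<Sigma>(1) \<Sigma>(2)[of "addf A" "{#F A#}"]
    by simp
qed

text \<open>The rule touches a node and its child, so the hole sits at the parent and the change in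
  the child is viewed as an update of the parent.\<close>

lemma fill_into_kid:
  assumes "valid (p @ [i]) t" and "A \<in> set (fms (sub p t))"
  obtains \<Sigma> where "seqt t = fill \<Sigma> {#F A, itemt (sub (p @ [i]) t)#}"
    and "seqt (upd (addf A) (p @ [i]) t) = fill \<Sigma> {#F A, itemt (addf A (sub (p @ [i]) t))#}"
proof -
  let ?s = "sub p t" and ?k = "sub (p @ [i]) t"
  have "{#F A#} + {#itemt ?k#} \<subseteq># seqt ?s"
    unfolding seqt_def using assms
    by (intro subset_mset.add_mono) (auto simp: mset_subset_eq_single)
  then have "{#F A, itemt ?k#} \<subseteq># seqt ?s"
    by (simp add: add_mset_commute)
  then obtain \<Sigma> where \<Sigma>: "seqt t = fill \<Sigma> {#F A, itemt ?k#}"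
    "\<And>h \<Theta>'. white (h ?s) = white ?s \<Longrightarrow> seqt (h ?s) + {#F A, itemt ?k#} = seqt ?s + \<Theta>' \<Longrightarrow>
      seqt (upd h p t) = fill \<Sigma> \<Theta>'"
    using upd_fill[of p t "{#F A, itemt ?k#}"] assms(1) unfolding valid_append by blast
  have "seqt (upd (addf A) (p @ [i]) t) = fill \<Sigma> {#F A, itemt (addf A ?k)#}"
    unfolding upd_append
    using assms(1) seqt_kid[of i ?s "addf A"] by (intro \<Sigma>(2)) simp_all
  with \<Sigma>(1) show thesis
    by (rule that)
qed

lemma fill_out_of_kid:
  assumes "valid (p @ [i]) t"
  obtains \<Sigma> where "seqt t = fill \<Sigma> {#itemt (sub (p @ [i]) t)#}"
    and "seqt (upd (addf A) p t) = fill \<Sigma> {#itemt (sub (p @ [i]) t), F A#}"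
proof -
  have "itemt (sub (p @ [i]) t) \<in># seqt (sub p t)"
    using assms by (simp add: seqt_def)
  then obtain \<Sigma> where "seqt t = fill \<Sigma> {#itemt (sub (p @ [i]) t)#}"
    "\<And>h \<Theta>. white (h (sub p t)) = white (sub p t) \<Longrightarrow> seqt (h (sub p t)) = seqt (sub p t) + \<Theta> \<Longrightarrow>
      seqt (upd h p t) = fill \<Sigma> (add_mset (itemt (sub (p @ [i]) t)) \<Theta>)"
    using node_fill[of p t] assms by (metis valid_append)
  then show thesis
    using that by simp
qed

lemma ds4t_dia_4:
  assumes "(p, q) \<in> edges t" and "Dia A \<in> set (fms (sub p t))"
    and "ds4t (upd (addf (Dia A)) q t)"
  shows "ds4t t"
proof -
  \<comment> \<open>An edge leaving \<open>p\<close> leads down into a white child, handled by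
    \<open>four_c\<close>, or up from a black one, handled by \<open>four_d\<close>.\<close>
  from assms(1) consider
      i where "q = p @ [i]" "valid (p @ [i]) t" "white (sub (p @ [i]) t)"
    | i where "p = q @ [i]" "valid (q @ [i]) t" "\<not> white (sub (q @ [i]) t)"
    unfolding edges_def by blast
  then show ?thesis
  proof cases
    case 1
    obtain \<Sigma> where "seqt t = fill \<Sigma> {#F (Dia A), itemt (sub q t)#}"
      "seqt (upd (addf (Dia A)) q t) = fill \<Sigma> {#F (Dia A), itemt (addf (Dia A) (sub q t))#}"
      using fill_into_kid[OF 1(2) assms(2)] 1(1) by blast
    then show ?thesis
      using derivable1[of DS4, OF DS4.four_c[of \<Sigma> A "seqt (sub q t)"]] assms(3) 1
        itemt_eq[of "sub q t"] itemt_eq[of "addf (Dia A) (sub q t)"]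
      by simp
  next
    case 2
    obtain \<Sigma> where \<Sigma>: "seqt t = fill \<Sigma> {#itemt (sub p t)#}"
      "seqt (upd (addf (Dia A)) q t) = fill \<Sigma> {#itemt (sub p t), F (Dia A)#}"
      using fill_out_of_kid[OF 2(2)] 2(1) by blast
    obtain \<Delta> where "seqt (sub p t) = \<Delta> + {#F (Dia A)#}"
      using formula_in_seqt[OF assms(2)] by (metis add_mset_add_single insert_DiffM)
    then have "itemt (sub p t) = B (\<Delta> + {#F (Dia A)#})"
      using 2 itemt_eq[of "sub p t"] by simp
    then show ?thesis
      using derivable1[of DS4, OF DS4.four_d[of \<Sigma> \<Delta> A]] assms(3) \<Sigma> by simp
  qed
qed

lemma ds4t_bdia_4:
  assumes "(q, p) \<in> edges t" and "BDia A \<in> set (fms (sub p t))"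
    and "ds4t (upd (addf (BDia A)) q t)"
  shows "ds4t t"
proof -
  from assms(1) consider
      i where "q = p @ [i]" "valid (p @ [i]) t" "\<not> white (sub (p @ [i]) t)"
    | i where "p = q @ [i]" "valid (q @ [i]) t" "white (sub (q @ [i]) t)"
    unfolding edges_def by blast
  then show ?thesis
  proof cases
    case 1
    obtain \<Sigma> where "seqt t = fill \<Sigma> {#F (BDia A), itemt (sub q t)#}"
      "seqt (upd (addf (BDia A)) q t) = fill \<Sigma> {#F (BDia A), itemt (addf (BDia A) (sub q t))#}"
      using fill_into_kid[OF 1(2) assms(2)] 1(1) by blast
    then show ?thesis
      using derivable1[of DS4, OF DS4.four_a[of \<Sigma> A "seqt (sub q t)"]] assms(3) 1
        itemt_eq[of "sub q t"] itemt_eq[of "addf (BDia A) (sub q t)"]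
      by simp
  next
    case 2
    obtain \<Sigma> where \<Sigma>: "seqt t = fill \<Sigma> {#itemt (sub p t)#}"
      "seqt (upd (addf (BDia A)) q t) = fill \<Sigma> {#itemt (sub p t), F (BDia A)#}"
      using fill_out_of_kid[OF 2(2)] 2(1) by blast
    obtain \<Delta> where "seqt (sub p t) = \<Delta> + {#F (BDia A)#}"
      using formula_in_seqt[OF assms(2)] by (metis add_mset_add_single insert_DiffM)
    then have "itemt (sub p t) = W (\<Delta> + {#F (BDia A)#})"
      using 2 itemt_eq[of "sub p t"] by simp
    then show ?thesis
      using derivable1[of DS4, OF DS4.four_b[of \<Sigma> \<Delta> A]] assms(3) \<Sigma> by simp
  qed
qed

text \<open>
  The 4-rules carry a diamond along a path and the T-rules unfold it at the end. The premise
  ranges over all extensions of \<open>t\<close> because the copies left on the way remain.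
\<close>

lemma ds4t_dia:
  assumes "(p, q) \<in> (edges t)\<^sup>*" and "valid p t" and "Dia A \<in> set (fms (sub p t))"
    and "\<And>u. ext t u \<Longrightarrow> A \<in> set (fms (sub q u)) \<Longrightarrow> ds4t u"
  shows "ds4t t"
proof -
  \<comment> \<open>The path is fixed in \<open>edges t\<close> while the tree grows, so the claim
    is generalised to all extensions of \<open>t\<close>, which keep these edges.\<close>
  have "ext t v \<Longrightarrow> valid p v \<Longrightarrow> Dia A \<in> set (fms (sub p v)) \<Longrightarrow>
    (\<And>u. ext v u \<Longrightarrow> A \<in> set (fms (sub q u)) \<Longrightarrow> ds4t u) \<Longrightarrow> ds4t v" for v
    using assms(1)
  proof (induction arbitrary: v rule: converse_rtrancl_induct)
    case base
    show ?case
      by (rule ds4t_dia_T[OF base(2,3)])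
        (use base in \<open>auto intro!: base(4) ext_upd ext_addf\<close>)
  next
    case (step p r)
    have e: "(p, r) \<in> edges v"
      using step.hyps(1) ext_edges[OF step.prems(1)] by blast
    let ?w = "upd (addf (Dia A)) r v"
    have r: "valid r v"
      using e edges_valid by blast
    have vw: "ext v ?w"
      using r by (intro ext_upd ext_addf)
    have "ds4t ?w"
    proof (rule step.IH)
      show "ext t ?w"
        using step.prems(1) vw by (rule ext_trans)
      show "valid r ?w"
        using vw r unfolding ext_def by blast
      show "Dia A \<in> set (fms (sub r ?w))"
        using r by simp
      show "ds4t u" if "ext ?w u" "A \<in> set (fms (sub q u))" for u
        using step.prems(4) ext_trans[OF vw that(1)] that(2) by blast
    qed
    then show ?case
      using ds4t_dia_4[OF e step.prems(3)] by blast
  qed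
  from this[of t] show ?thesis
    using assms ext_refl by blast
qed

lemma ds4t_bdia:
  assumes "(q, p) \<in> (edges t)\<^sup>*" and "valid p t" and "BDia A \<in> set (fms (sub p t))"
    and "\<And>u. ext t u \<Longrightarrow> A \<in> set (fms (sub q u)) \<Longrightarrow> ds4t u"
  shows "ds4t t"
proof -
  have "ext t v \<Longrightarrow> valid p v \<Longrightarrow> BDia A \<in> set (fms (sub p v)) \<Longrightarrow>
    (\<And>u. ext v u \<Longrightarrow> A \<in> set (fms (sub q u)) \<Longrightarrow> ds4t u) \<Longrightarrow> ds4t v" for v
    using assms(1)
  \<comment> \<open>A past diamond travels against the edges, so the last edge of the path is the
    first to be crossed.\<close>
  proof (induction arbitrary: v rule: rtrancl_induct)
    case base
    show ?case
      by (rule ds4t_bdia_T[OF base(2,3)])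
        (use base in \<open>auto intro!: base(4) ext_upd ext_addf\<close>)
  next
    case (step r p)
    have e: "(r, p) \<in> edges v"
      using step.hyps(2) ext_edges[OF step.prems(1)] by blast
    let ?w = "upd (addf (BDia A)) r v"
    have r: "valid r v"
      using e edges_valid by blast
    have vw: "ext v ?w"
      using r by (intro ext_upd ext_addf)
    have "ds4t ?w"
    proof (rule step.IH)
      show "ext t ?w"
        using step.prems(1) vw by (rule ext_trans)
      show "valid r ?w"
        using vw r unfolding ext_def by blast
      show "BDia A \<in> set (fms (sub r ?w))"
        using r by simp
      show "ds4t u" if "ext ?w u" "A \<in> set (fms (sub q u))" for u
        using step.prems(4) ext_trans[OF vw that(1)] that(2) by blast
    qed
    then show ?case
      using ds4t_bdia_4[OF e step.prems(3)] by blast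
  qed
  from this[of t] show ?thesis
    using assms ext_refl by blast
qed

section \<open>From refutations to deep derivations\<close>

primrec labs :: "'a fact \<Rightarrow> 'a lbl set" where
  "labs (Lab x A) = {x}"
| "labs (Edge x y) = {x, y}"

definition occ :: "'a fact set \<Rightarrow> 'a lbl set" where
  "occ S = (\<Union>f \<in> S. labs f)"

text \<open>This substitutes for freshness: if the defining facts of a witness are not all present,
  its label does not occur and may be sent to a new node.\<close>

definition wit_ok :: "'a fact set \<Rightarrow> bool" where
  "wit_ok S \<longleftrightarrow> (\<forall>x A. Wit x A \<in> occ S \<longrightarrow> wfacts x A \<subseteq> S)"

definition embeds :: "('a lbl \<Rightarrow> nat list) \<Rightarrow> 'a fact set \<Rightarrow> 'a ntree \<Rightarrow> bool" where
  "embeds g S t \<longleftrightarrow>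
    (\<forall>x A. Lab x A \<in> S \<longrightarrow> valid (g x) t \<and> A \<in> set (fms (sub (g x) t))) \<and>
    (\<forall>x y. Edge x y \<in> S \<longrightarrow> (g x, g y) \<in> edges t)"

lemma occ_insert [simp]: "occ (insert f S) = labs f \<union> occ S"
  by (simp add: occ_def)

lemma occ_Lab: "Lab x A \<in> S \<Longrightarrow> x \<in> occ S"
  unfolding occ_def by force

lemma wit_ok_insert: "wit_ok S \<Longrightarrow> labs f \<subseteq> occ S \<Longrightarrow> wit_ok (insert f S)"
  unfolding wit_ok_def by auto

lemma wit_ok_wfacts:
  assumes "wit_ok S" and "x \<in> occ S"
  shows "wit_ok (S \<union> wfacts x A)"
proof -
  have "occ (S \<union> wfacts x A) \<subseteq> insert (Wit x A) (occ S)"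
    using assms(2) by (cases A) (auto simp: occ_def)
  moreover have "wfacts x A = {}" if "Wit x A \<notin> occ (wfacts x A)"
    using that by (cases A) auto
  ultimately show ?thesis
    using assms(1) unfolding wit_ok_def by blast
qed

text \<open>Both ends of an edge occur, and the trivial path changes nothing. Hence a diamond step
  introduces no new label and preserves \<open>wit_ok\<close>.\<close>

lemma reach_occ:
  assumes "(x, y) \<in> reach S"
  shows "x \<in> occ S \<longleftrightarrow> y \<in> occ S"
  using assms unfolding reach_def
proof (induction rule: rtrancl_induct)
  case (step y z)
  then have "y \<in> occ S" "z \<in> occ S"
    unfolding occ_def by force+
  then show ?case using step by blast
qed simp

lemma embeds_Lab: "embeds g S t \<Longrightarrow> Lab x A \<in> S \<Longrightarrow> valid (g x) t \<and> A \<in> set (fms (sub (g x) t))"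
  unfolding embeds_def by blast

lemma embeds_ext: "embeds g S t \<Longrightarrow> ext t u \<Longrightarrow> embeds g S u"
  using ext_edges[of t u] unfolding embeds_def ext_def by blast

lemma embeds_insert:
  "embeds g S t \<Longrightarrow> valid (g x) t \<Longrightarrow> A \<in> set (fms (sub (g x) t)) \<Longrightarrow> embeds g (insert (Lab x A) S) t"
  unfolding embeds_def by auto

lemma embeds_addf:
  assumes "embeds g S t" and "valid (g x) t"
  shows "embeds g (insert (Lab x A) S) (upd (addf A) (g x) t)"
proof -
  have "ext t (upd (addf A) (g x) t)"
    using assms(2) by (intro ext_upd ext_addf)
  then show ?thesis
    using assms embeds_ext unfolding ext_def by (intro embeds_insert) auto
qed

lemma embeds_reach:
  assumes "embeds g S t" and "(x, y) \<in> reach S"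
  shows "(g x, g y) \<in> (edges t)\<^sup>*"
  using assms(2) unfolding reach_def
proof (induction rule: rtrancl_induct)
  case (step y z)
  then have "(g y, g z) \<in> edges t"
    using assms(1) unfolding embeds_def by blast
  with step show ?case by (meson rtrancl.rtrancl_into_rtrancl)
qed simp

lemma edges_rtrancl_valid:
  assumes "(p, q) \<in> (edges t)\<^sup>*"
  shows "valid p t \<longleftrightarrow> valid q t"
  using assms by (induction rule: rtrancl_induct) (use edges_valid in blast)+

text \<open>The old number of children is the index of the appended child. Redirecting
  \<open>g\<close> at the witness disturbs no recorded fact because the witness does not occur in
  \<open>S\<close>.\<close>

lemma embeds_addk:
  fixes g :: "'a lbl \<Rightarrow> nat list" and c :: bool and A C :: "'a fm" and t :: "'a ntree"
  defines "u x \<equiv> upd (addk (Node c [A] [])) (g x) t"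
    and "q x \<equiv> g x @ [length (kids (sub (g x) t))]"
  assumes "embeds g S t" and "valid (g x) t" and "Wit x C \<notin> occ S"
  shows "embeds (g(Wit x C := q x)) S (u x)"
    and "valid (q x) (u x)" and "fms (sub (q x) (u x)) = [A]"
    and "(if c then (g x, q x) else (q x, g x)) \<in> edges (u x)"
proof -
  have e: "ext t (u x)"
    unfolding u_def using assms(4) by (intro ext_upd ext_addk)
  have "embeds g S (u x)"
    using assms(3) e by (rule embeds_ext)
  then show "embeds (g(Wit x C := q x)) S (u x)"
    using assms(5) unfolding embeds_def occ_def by force
  have v: "valid (g x) (u x)"
    using e assms(4) unfolding ext_def by blast
  have s: "sub (g x) (u x) = addk (Node c [A] []) (sub (g x) t)"
    unfolding u_def using assms(4) by simp
  show *: "valid (q x) (u x)" "fms (sub (q x) (u x)) = [A]"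
    using v s unfolding q_def by simp_all
  have "white (sub (q x) (u x)) = c"
    using s unfolding q_def by simp
  then show "(if c then (g x, q x) else (q x, g x)) \<in> edges (u x)"
    using *(1) unfolding q_def edges_def by auto
qed

text \<open>Each rule for label \<open>x\<close> is replayed at address \<open>g x\<close>. Both
  \<open>g\<close> and \<open>t\<close> vary in the induction, since witnesses extend
  \<open>g\<close> and every premise may live on a larger tree.\<close>

lemma ds4t_if_refut: "refut S \<Longrightarrow> wit_ok S \<Longrightarrow> embeds g S t \<Longrightarrow> ds4t t"
proof (induction arbitrary: g t rule: refut.induct)
  case (id x a S)
  then show ?case
    using embeds_Lab[OF id(4)] by (blast intro: ds4t_id)
next
  case (conj x A C S)
  have x: "valid (g x) t" "And A C \<in> set (fms (sub (g x) t))"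
    using embeds_Lab conj by blast+
  have "wit_ok (insert (Lab x A) S)" "wit_ok (insert (Lab x C) S)"
    using conj by (auto intro!: wit_ok_insert simp: occ_Lab)
  then have "ds4t (upd (addf A) (g x) t)" "ds4t (upd (addf C) (g x) t)"
    using conj.IH embeds_addf[OF conj.prems(2) x(1)] by blast+
  with x show ?case
    by (rule ds4t_conj)
next
  case (disj x A C S)
  have x: "valid (g x) t" "Or A C \<in> set (fms (sub (g x) t))"
    using embeds_Lab disj by blast+
  let ?u = "upd (addf A \<circ> addf C) (g x) t"
  have e: "ext t ?u"
    using ext_upd[OF x(1)] ext_trans[OF ext_addf ext_addf] by (metis comp_apply)
  have "ds4t ?u"
    using disj x e embeds_ext
    by (intro disj.IH wit_ok_insert embeds_insert) (auto simp: occ_Lab ext_def)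
  with x show ?case
    by (rule ds4t_disj)
next
  case (wit x A S)
  have x: "valid (g x) t" "A \<in> set (fms (sub (g x) t))"
    using embeds_Lab wit by blast+
  have ok: "wit_ok (S \<union> wfacts x A)"
    using wit by (intro wit_ok_wfacts occ_Lab)
  show ?case
  \<comment> \<open>A witness already present, or a formula that is no box, makes the step idle: the
    same tree is kept and no child is added.\<close>
  proof (cases "wfacts x A \<subseteq> S")
    case True
    then show ?thesis
      using wit ok by (metis sup.absorb1)
  next
    case False
    then have new: "Wit x A \<notin> occ S"
      using wit.prems(1) unfolding wit_ok_def by blast
    \<comment> \<open>This keeps the address of \<open>x\<close> unchanged when \<open>g\<close> is
      redirected at the witness.\<close>
    then have "x \<noteq> Wit x A"
      using occ_Lab[OF wit.hyps(1)] by metis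
    let ?q = "g x @ [length (kids (sub (g x) t))]"
    from False consider C where "A = Box C" | C where "A = BBox C"
      by (cases A) auto
    then show ?thesis
    proof cases
      case 1
      let ?u = "upd (addk (Node True [C] [])) (g x) t"
      have "embeds (g(Wit x A := ?q)) (S \<union> wfacts x A) ?u"
        using embeds_addk[OF wit.prems(2) x(1) new, of True C] \<open>x \<noteq> Wit x A\<close> 1
        unfolding embeds_def by (auto simp del: valid_append sub_append)
      then have "ds4t ?u"
        by (rule wit.IH[OF ok])
      then show ?thesis
        using ds4t_box x 1 by blast
    next
      case 2
      let ?u = "upd (addk (Node False [C] [])) (g x) t"
      have "embeds (g(Wit x A := ?q)) (S \<union> wfacts x A) ?u"
        using embeds_addk[OF wit.prems(2) x(1) new, of False C] \<open>x \<noteq> Wit x A\<close> 2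
        unfolding embeds_def by (auto simp del: valid_append sub_append)
      then have "ds4t ?u"
        by (rule wit.IH[OF ok])
      then show ?thesis
        using ds4t_bbox x 2 by blast
    qed
  qed
next
  case (dia x A S y)
  have x: "valid (g x) t" "Dia A \<in> set (fms (sub (g x) t))"
    using embeds_Lab dia by blast+
  have r: "(g x, g y) \<in> (edges t)\<^sup>*"
    using embeds_reach dia by blast
  have ok: "wit_ok (insert (Lab y A) S)"
    using dia.prems(1) reach_occ[OF dia.hyps(2)] occ_Lab[OF dia.hyps(1)]
    by (intro wit_ok_insert) simp_all
  show ?case
  proof (rule ds4t_dia[OF r x])
    fix u assume u: "ext t u" "A \<in> set (fms (sub (g y) u))"
    then have "valid (g y) u"
      using x(1) edges_rtrancl_valid[OF r] unfolding ext_def by blast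
    with u show "ds4t u"
      using embeds_ext[OF dia.prems(2) u(1)] by (intro dia.IH[OF ok] embeds_insert)
  qed
next
  case (bdia x A S y)
  have x: "valid (g x) t" "BDia A \<in> set (fms (sub (g x) t))"
    using embeds_Lab bdia by blast+
  have r: "(g y, g x) \<in> (edges t)\<^sup>*"
    using embeds_reach bdia by blast
  have ok: "wit_ok (insert (Lab y A) S)"
    using bdia.prems(1) reach_occ[OF bdia.hyps(2)] occ_Lab[OF bdia.hyps(1)]
    by (intro wit_ok_insert) simp_all
  show ?case
  proof (rule ds4t_bdia[OF r x])
    fix u assume u: "ext t u" "A \<in> set (fms (sub (g y) u))"
    then have "valid (g y) u"
      using x(1) edges_rtrancl_valid[OF r] unfolding ext_def by blast
    with u show "ds4t u"
      using embeds_ext[OF bdia.prems(2) u(1)] by (intro bdia.IH[OF ok] embeds_insert)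
  qed
qed

section \<open>Facts of a tree and the completeness argument\<close>

definition tfacts :: "'a ntree \<Rightarrow> 'a fact set" where
  "tfacts t = {Lab (Pos p) A | p A. valid p t \<and> A \<in> set (fms (sub p t))} \<union>
    {Edge (Pos p) (Pos q) | p q. (p, q) \<in> edges t}"

lemma wit_ok_tfacts: "wit_ok (tfacts t)"
  unfolding wit_ok_def occ_def tfacts_def by auto

text \<open>The value \<open>[]\<close> at witnesses is an arbitrary default, since only
  \<open>Pos\<close> labels occur in \<open>tfacts t\<close>.\<close>

lemma embeds_tfacts: "embeds (\<lambda>x. case x of Pos p \<Rightarrow> p | Wit _ _ \<Rightarrow> []) (tfacts t) t"
  unfolding embeds_def tfacts_def by auto

text \<open>A structure fails at a node because its own address is accessible in the direction given
  by its colour and, by induction on the subtree, falsifies its content.\<close>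

lemma not_ssat_tfacts:
  assumes "tfacts t \<subseteq> M" and "\<And>x A. Lab x A \<in> M \<Longrightarrow> \<not> sat (reach M) V A x" and "valid p t"
  shows "\<not> ssat (reach M) V (seqt (sub p t)) (Pos p)"
  using assms(3)
proof (induction "sub p t" arbitrary: p)
  case (Node c As ts)
  have "\<not> sat (reach M) V A (Pos p)" if "A \<in> set (fms (sub p t))" for A
    using that Node.prems assms(1,2) unfolding tfacts_def by blast
  moreover have "\<not> isat (reach M) V (itemt k) (Pos p)" if k: "k \<in> set (kids (sub p t))" for k
  proof -
    obtain i where i: "i < length (kids (sub p t))" "k = kids (sub p t) ! i"
      using k by (metis in_set_conv_nth)
    have v: "valid (p @ [i]) t" "k = sub (p @ [i]) t"
      using i Node.prems by simp_all
    then have "if white k then (p, p @ [i]) \<in> edges t else (p @ [i], p) \<in> edges t"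
      unfolding edges_def by auto
    then have "if white k then (Pos p, Pos (p @ [i])) \<in> reach M else (Pos (p @ [i]), Pos p) \<in> reach M"
      using assms(1) unfolding tfacts_def reach_def by (auto split: if_splits intro!: r_into_rtrancl)
    moreover have "\<not> ssat (reach M) V (seqt k) (Pos (p @ [i]))"
      using Node.hyps(1)[of "p @ [i]"] k v Node.hyps(2) by (metis ntree.sel(3))
    ultimately show ?thesis
      by (auto simp: itemt_eq split: if_splits)
  qed
  ultimately show ?case
    unfolding ssat_def seqt_def by auto
qed

lemma ds4_if_ss4:
  assumes "ss4 \<Gamma>"
  shows "derivable DS4 \<Gamma>"
proof -
  obtain t where t: "seqt t = \<Gamma>"
    using seqt_surj by blast
  have "refut (tfacts t)"
  proof (rule ccontr)
    assume "\<not> refut (tfacts t)"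
    then obtain M where M: "tfacts t \<subseteq> M" "\<not> refut M"
      "\<And>X. M \<subseteq> X \<Longrightarrow> \<not> refut X \<Longrightarrow> X = M"
      using refut_maximal by blast
    let ?V = "\<lambda>x a. Lab x (Atom a) \<notin> M"
    \<comment> \<open>The root falsifies the whole sequent in the countermodel, against soundness of
      SS4 with cut.\<close>
    have "\<not> ssat (reach M) ?V (seqt (sub [] t)) (Pos [])"
      using M(1) maximal_falsified[OF M(2,3)] by (rule not_ssat_tfacts) simp_all
    moreover have "refl (reach M)" "trans (reach M)"
      unfolding reach_def by (rule refl_rtrancl, rule trans_rtrancl)
    ultimately show False
      using ss4_sound[OF assms, of "reach M" ?V "Pos []"] t by simp
  qed
  then show ?thesis
    using ds4t_if_refut wit_ok_tfacts embeds_tfacts t by blast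
qed

theorem theorem5p7:
  fixes \<Gamma> :: "'a seq"
  shows "derivable SS4 \<Gamma> \<longleftrightarrow> derivable DS4 \<Gamma>"
  using ds4_if_ss4 ss4_if_ds4 by blast

end
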